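(* Let $T$ be a semi-infinite banded stochastic matrix ($p$ subdiagonals, $q$ superdiagonals) admitting a positive bidiagonal factorization, let $N\in\mathbb N_0$, and let $\hat T^{[N]}=\frac{1}{\lambda_0^{[N]}}\delta(u_0^{\langle N\rangle})^{-1}T^{[N]}\delta(u_0^{\langle N\rangle})$. With $x_N:=x/\lambda_0^{[N]}$, for all $k\in\mathbb N_0$ and $n,m\in\{0,\dots,N\}$, $$\begin{aligned}((\hat T^{[N]})^k)_{n,m}&=\frac{u_{0,m}^{\langle N\rangle}}{u_{0,n}^{\langle N\rangle}}\sum_{a=1}^p\sum_{b=1}^{q}\int B^{(b)}_n(x)\,x_N^k\,\mathrm d\psi^{[N]}_{b,a}(x)\,A^{(a)}_{m}(x)\\&=\frac{u_{0,m}^{\langle N\rangle}}{u_{0,n}^{\langle N\rangle}}\sum_{j=0}^N u_{j,n}^{\langle N\rangle}\Big(\frac{\lambda^{[N]}_j}{\lambda_0^{[N]}}\Big)^k w_{j,m}^{\langle N\rangle}\\&=u_{0,m}^{\langle N\rangle}w_{0,m}^{\langle N\rangle}+\frac{u_{0,m}^{\langle N\rangle}}{u_{0,n}^{\langle N\rangle}}\sum_{j=1}^N u_{j,n}^{\langle N\rangle}\Big(\frac{\lambda^{[N]}_j}{\lambda_0^{[N]}}\Big)^k w_{j,m}^{\langle N\rangle}.\end{aligned}$$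
   Context: Semi-infinite matrices are indexed by $\mathbb N_0$. $p,q\ge1$ are integers. $T$ is stochastic (nonnegative entries, rows sum to $1$) and banded: $T_{n,m}=0$ unless $n-p\le m\le n+q$, with positive entries inside the band. A positive bidiagonal factorization is $T=\mathscr L_1\cdots\mathscr L_p\mathscr U_q\cdots\mathscr U_1$ with each $\mathscr L_i$ lower bidiagonal with positive main diagonal and first subdiagonal, and each $\mathscr U_j$ upper bidiagonal with positive main diagonal and first superdiagonal (all other entries zero). $\delta(v)$ is the diagonal matrix with diagonal $v$. $T^{[N]}=(T_{n,m})_{n,m=0}^N$; its eigenvalues $\lambda_0^{[N]}>\dots>\lambda_N^{[N]}$ are simple and positive (known). Recursion polynomials. Fix real unitriangular lower matrices $\nu\in\mathbb R^{p\times p}$ and $\xi\in\mathbb R^{q\times q}$ (ones on the diagonal, zeros above). For $a\in\{1,\dots,p\}$, the polynomials $A^{(a)}_n(x)$, $n\ge0$, are determined by $A^{(a)}_n=\nu_{n+1,a}$ for $0\le n\le p-1$ and the left eigenvector relation $\sum_{l\ge0}A^{(a)}_l T_{l,n}=xA^{(a)}_n$, $n\ge0$. For $b\in\{1,\dots,q\}$, $B^{(b)}_n(x)$ are determined by $B^{(b)}_n=\xi_{n+1,b}$ for $0\le n\le q-1$ and $\sum_{l\ge0}T_{n,l}B^{(b)}_l=xB^{(b)}_n$, $n\ge0$. Let $P_0=1$, $P_{M}(x)=\det(xI_{M}-T^{[M-1]})$ for $M\ge1$; $\alpha_0=\beta_0=1$, $\alpha_N=(-1)^{(p-1)N}T_{p,0}\cdots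 T_{N+p-1,N-1}$, $\beta_N=(-1)^{(q-1)N}T_{0,q}\cdots T_{N-1,N+q-1}$ for $N\ge 1$. For $n\ge0$, $Q_{n,N}$ is the $p\times p$ determinant with rows $(A^{(1)}_l,\dots,A^{(p)}_l)$, $l=n,N+1,\dots,N+p-1$ (in this order), and $R_{n,N}$ is the $q\times q$ determinant with rows $(B^{(1)}_l,\dots,B^{(q)}_l)$, $l=n,N+1,\dots,N+q-1$. Eigenvectors: $u^{\langle N\rangle}_{k,n}=\beta_N R_{n,N}(\lambda_k^{[N]})$ and $w^{\langle N\rangle}_{k,n}=\dfrac{\alpha_N Q_{n,N}(\lambda_k^{[N]})}{P_N(\lambda_k^{[N]})P_{N+1}'(\lambda_k^{[N]})}$ for $n\ge 0$ (so $u_{k,n}^{\langle N\rangle}=0$ for $N<n\le N+q-1$ and $w_{k,n}^{\langle N\rangle}=0$ for $N<n\le N+p-1$). Known facts: $u^{\langle N\rangle}_k=(u_{k,n}^{\langle N\rangle})_{n=0}^N$ (column) and $w^{\langle N\rangle}_k=(w_{k,n}^{\langle N\rangle})_{n=0}^N$ (row) are right and left eigenvectors of $T^{[N]}$ for $\lambda_k^{[N]}$, with $w_k^{\langle N\rangle}u_l^{\langle N\rangle}=\delta_{k,l}$, and $u^{\langle N\rangle}_0,w^{\langle N\rangle}_0$ have all entries positive. Christoffel numbers: $(\mu_{k,1}^{[N]},\dots,\mu_{k,p}^{[N]})^\top=\nu^{-1}(w_{k,0}^{\langle N\rangle},\dots,w_{k,p-1}^{\langle N\rangle})^\top$, $(\rho_{k,1}^{[N]},\dots,\rho_{k,q}^{[N]})^\top=\xi^{-1}(u_{k,0}^{\langle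 N\rangle},\dots,u_{k,q-1}^{\langle N\rangle})^\top$; one has $w_{k,n}^{\langle N\rangle}=\sum_a A_n^{(a)}(\lambda_k^{[N]})\mu_{k,a}^{[N]}$, $u_{k,n}^{\langle N\rangle}=\sum_b B_n^{(b)}(\lambda_k^{[N]})\rho_{k,b}^{[N]}$. The discrete measures are $\mathrm d\psi^{[N]}_{b,a}=\sum_{k=0}^N\rho^{[N]}_{k,b}\mu^{[N]}_{k,a}\,\delta_{\lambda_k^{[N]}}$ (point masses at the eigenvalues). *)

theory Defs
  imports
    "HOL-Probability.Giry_Monad"
    "HOL-Library.Groups_Big_Fun"
    "Jordan_Normal_Form.Matrix"
    "Jordan_Normal_Form.Determinant"
    "Jordan_Normal_Form.Char_Poly"
    "Jordan_Normal_Form.Gauss_Jordan_Elimination"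
begin

text \<open>
  Semi-infinite matrices are functions on pairs of natural numbers, finite matrices and vectors
  are those of Jordan-Normal-Form. The indices \<open>a \<in> {1..p}\<close> and \<open>b \<in> {1..q}\<close> start at 1, as does
  the numbering of the bidiagonal factors; all other indices start at 0.
  Sums over all of \<open>\<nat>\<close> of finitely supported families are written with \<^const>\<open>Sum_any\<close>.
\<close>

type_synonym smat = "nat \<Rightarrow> nat \<Rightarrow> real"

section \<open>Stochastic banded matrices and positive bidiagonal factorizations\<close>

definition stochastic :: "smat \<Rightarrow> bool" where
  "stochastic T \<longleftrightarrow> (\<forall>n m. 0 \<le> T n m) \<and> (\<forall>n. (\<lambda>m. T n m) sums 1)"

text \<open>The lower band condition \<open>n - p \<le> m\<close> is written \<open>n \<le> m + p\<close> to avoid truncated subtraction.\<close>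

definition pos_banded :: "nat \<Rightarrow> nat \<Rightarrow> smat \<Rightarrow> bool" where
  "pos_banded p q T \<longleftrightarrow>
     (\<forall>n m. if n \<le> m + p \<and> m \<le> n + q then 0 < T n m else T n m = 0)"

definition smat_mult :: "smat \<Rightarrow> smat \<Rightarrow> smat" where
  "smat_mult X Y = (\<lambda>n m. Sum_any (\<lambda>l. X n l * Y l m))"

definition smat_one :: smat where
  "smat_one = (\<lambda>n m. if n = m then 1 else 0)"

definition smat_prod_list :: "smat list \<Rightarrow> smat" where
  "smat_prod_list Xs = foldr smat_mult Xs smat_one"

definition pos_lower_bidiagonal :: "smat \<Rightarrow> bool" where
  "pos_lower_bidiagonal L \<longleftrightarrow>
     (\<forall>n m. if n = m \<or> n = Suc m then 0 < L n m else L n m = 0)"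

definition pos_upper_bidiagonal :: "smat \<Rightarrow> bool" where
  "pos_upper_bidiagonal U \<longleftrightarrow>
     (\<forall>n m. if m = n \<or> m = Suc n then 0 < U n m else U n m = 0)"

text \<open>\<open>T = L\<^sub>1 \<cdots> L\<^sub>p U\<^sub>q \<cdots> U\<^sub>1\<close>. All factors have finitely supported rows, so every sum
  in the products is finite.\<close>

definition has_pos_bidiagonal_factorization :: "nat \<Rightarrow> nat \<Rightarrow> smat \<Rightarrow> bool" where
  "has_pos_bidiagonal_factorization p q T \<longleftrightarrow>
     (\<exists>L U. (\<forall>i\<in>{1..p}. pos_lower_bidiagonal (L i)) \<and>
            (\<forall>j\<in>{1..q}. pos_upper_bidiagonal (U j)) \<and>
            T = smat_prod_list (map L [1..<Suc p] @ map U (rev [1..<Suc q])))"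

section \<open>Truncations, characteristic polynomials, eigenvalues\<close>

definition trunc :: "smat \<Rightarrow> nat \<Rightarrow> real mat" where
  "trunc T N = Matrix.mat (Suc N) (Suc N) (\<lambda>(n, m). T n m)"

definition charP :: "smat \<Rightarrow> nat \<Rightarrow> real poly" where
  "charP T M = (case M of 0 \<Rightarrow> 1 | Suc N \<Rightarrow> char_poly (trunc T N))"

text \<open>The eigenvalues in strictly decreasing order, \<open>\<lambda>\<^sub>0\<close> being the largest one. For the matrices
  with a positive bidiagonal factorization all \<open>N + 1\<close> eigenvalues of the truncation are real and
  simple, so that the list has length \<open>N + 1\<close> and \<open>lam T N k\<close> is meaningful for \<open>k \<le> N\<close>.\<close>

definition lam :: "smat \<Rightarrow> nat \<Rightarrow> nat \<Rightarrow> real" where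
  "lam T N k = rev (sorted_list_of_set {x. eigenvalue (trunc T N) x}) ! k"

section \<open>Recursion polynomials\<close>

definition lower_unitriangular :: "nat \<Rightarrow> real mat \<Rightarrow> bool" where
  "lower_unitriangular d M \<longleftrightarrow> M \<in> carrier_mat d d \<and>
     (\<forall>i<d. M $$ (i, i) = 1) \<and> (\<forall>i<d. \<forall>j<d. i < j \<longrightarrow> M $$ (i, j) = 0)"

text \<open>The polynomial \<open>x\<close> is \<open>[:0, 1:]\<close>, and the entry \<open>\<nu>\<^sub>n\<^sub>+\<^sub>1\<^sub>,\<^sub>a\<close> of the 1-based convention is
  \<open>\<nu> $$ (n, a - 1)\<close>. For a matrix with positive entries inside the band
  each of the two predicates determines the polynomials uniquely.\<close>

definition left_recursion_polys ::
    "nat \<Rightarrow> smat \<Rightarrow> real mat \<Rightarrow> (nat \<Rightarrow> nat \<Rightarrow> real poly) \<Rightarrow> bool" where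
  "left_recursion_polys p T \<nu> A \<longleftrightarrow>
     (\<forall>a\<in>{1..p}. (\<forall>n<p. A a n = [:\<nu> $$ (n, a - 1):]) \<and>
        (\<forall>n. Sum_any (\<lambda>l. Polynomial.smult (T l n) (A a l)) = [:0, 1:] * A a n))"

definition right_recursion_polys ::
    "nat \<Rightarrow> smat \<Rightarrow> real mat \<Rightarrow> (nat \<Rightarrow> nat \<Rightarrow> real poly) \<Rightarrow> bool" where
  "right_recursion_polys q T \<xi> B \<longleftrightarrow>
     (\<forall>b\<in>{1..q}. (\<forall>n<q. B b n = [:\<xi> $$ (n, b - 1):]) \<and>
        (\<forall>n. Sum_any (\<lambda>l. Polynomial.smult (T n l) (B b l)) = [:0, 1:] * B b n))"

text \<open>The determinant with rows \<open>(C\<^sup>(\<^sup>1\<^sup>)\<^sub>l, \<dots>, C\<^sup>(\<^sup>d\<^sup>)\<^sub>l)\<close> for \<open>l = n, N+1, \<dots>, N+d-1\<close>. It is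
  \<open>Q\<^sub>n\<^sub>,\<^sub>N\<close> for \<open>C = A\<close>, \<open>d = p\<close> and \<open>R\<^sub>n\<^sub>,\<^sub>N\<close> for \<open>C = B\<close>, \<open>d = q\<close>.\<close>

definition rec_det :: "nat \<Rightarrow> (nat \<Rightarrow> nat \<Rightarrow> real poly) \<Rightarrow> nat \<Rightarrow> nat \<Rightarrow> real poly" where
  "rec_det d C n N =
     Determinant.det (Matrix.mat d d (\<lambda>(i, j). C (Suc j) (if i = 0 then n else N + i)))"

definition alpha :: "nat \<Rightarrow> smat \<Rightarrow> nat \<Rightarrow> real" where
  "alpha p T N = (-1) ^ ((p - 1) * N) * (\<Prod>i<N. T (p + i) i)"

definition beta :: "nat \<Rightarrow> smat \<Rightarrow> nat \<Rightarrow> real" where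
  "beta q T N = (-1) ^ ((q - 1) * N) * (\<Prod>i<N. T i (q + i))"

section \<open>Eigenvectors, Christoffel numbers, discrete measures\<close>

definition uvec :: "nat \<Rightarrow> smat \<Rightarrow> (nat \<Rightarrow> nat \<Rightarrow> real poly) \<Rightarrow> nat \<Rightarrow> nat \<Rightarrow> nat \<Rightarrow> real" where
  "uvec q T B N k n = beta q T N * poly (rec_det q B n N) (lam T N k)"

definition wvec :: "nat \<Rightarrow> smat \<Rightarrow> (nat \<Rightarrow> nat \<Rightarrow> real poly) \<Rightarrow> nat \<Rightarrow> nat \<Rightarrow> nat \<Rightarrow> real" where
  "wvec p T A N k n = alpha p T N * poly (rec_det p A n N) (lam T N k) /
     (poly (charP T N) (lam T N k) * poly (pderiv (charP T (Suc N))) (lam T N k))"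

text \<open>The value is unspecified for a matrix that is not invertible.\<close>

definition mat_inv :: "real mat \<Rightarrow> real mat" where
  "mat_inv M = the (mat_inverse M)"

definition christoffel_mu :: "nat \<Rightarrow> smat \<Rightarrow> real mat \<Rightarrow> (nat \<Rightarrow> nat \<Rightarrow> real poly) \<Rightarrow>
    nat \<Rightarrow> nat \<Rightarrow> nat \<Rightarrow> real" where
  "christoffel_mu p T \<nu> A N k a = vec_index (mat_inv \<nu> *\<^sub>v Matrix.vec p (\<lambda>n. wvec p T A N k n)) (a - 1)"

definition christoffel_rho :: "nat \<Rightarrow> smat \<Rightarrow> real mat \<Rightarrow> (nat \<Rightarrow> nat \<Rightarrow> real poly) \<Rightarrow>
    nat \<Rightarrow> nat \<Rightarrow> nat \<Rightarrow> real" where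
  "christoffel_rho q T \<xi> B N k b = vec_index (mat_inv \<xi> *\<^sub>v Matrix.vec q (\<lambda>n. uvec q T B N k n)) (b - 1)"

text \<open>The integral of \<open>f\<close> against \<open>d\<psi>\<^sub>b\<^sub>,\<^sub>a = \<Sum>\<^sub>k \<rho>\<^sub>k\<^sub>,\<^sub>b \<mu>\<^sub>k\<^sub>,\<^sub>a \<delta>\<close> (point masses at the eigenvalues).
  The weights need not be nonnegative for arbitrary \<open>\<nu>\<close> and \<open>\<xi>\<close>, so this is a signed measure; the
  integral against a finite real combination of Dirac measures is the same
  combination of the integrals. \<^term>\<open>return borel c\<close> is the Dirac measure at \<open>c\<close>.\<close>

definition psi_integral :: "nat \<Rightarrow> nat \<Rightarrow> smat \<Rightarrow> real mat \<Rightarrow> real mat \<Rightarrow>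
    (nat \<Rightarrow> nat \<Rightarrow> real poly) \<Rightarrow> (nat \<Rightarrow> nat \<Rightarrow> real poly) \<Rightarrow> nat \<Rightarrow> nat \<Rightarrow> nat \<Rightarrow>
    (real \<Rightarrow> real) \<Rightarrow> real" where
  "psi_integral p q T \<nu> \<xi> A B N b a f =
     (\<Sum>k=0..N. christoffel_rho q T \<xi> B N k b * christoffel_mu p T \<nu> A N k a *
        integral\<^sup>L (return borel (lam T N k)) f)"

section \<open>The normalized truncation\<close>

definition That :: "nat \<Rightarrow> smat \<Rightarrow> (nat \<Rightarrow> nat \<Rightarrow> real poly) \<Rightarrow> nat \<Rightarrow> real mat" where
  "That q T B N = (let D = mat_diag (Suc N) (uvec q T B N 0) in
     (1 / lam T N 0) \<cdot>\<^sub>m (mat_inv D * trunc T N * D))"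

end

theory Submission
  imports Defs
begin

text \<open>
  The number of sign changes of a vector does not increase under bidiagonal matrices with
  nonnegative entries. Applied to an eigenvector of a truncation, extended by one zero component,
  this fixes the sign of the next component of its image under \<open>T\<close>, which yields
  \<open>P\<^sub>N\<^sub>+\<^sub>2 P\<^sub>N < 0\<close> at the positive roots of \<open>P\<^sub>N\<^sub>+\<^sub>1\<close>. As in Sturm's theorem, the eigenvalues of
  consecutive truncations are then simple, positive and strictly interlacing.
  The scaled determinants \<open>U\<^sub>n = \<beta>\<^sub>N R\<^sub>n\<^sub>,\<^sub>N\<close> satisfy \<open>(x - T\<^sup>[\<^sup>N\<^sup>]) U = P\<^sub>N\<^sub>+\<^sub>1 e\<^sub>N\<close> with \<open>U\<^sub>N = P\<^sub>N\<close>, and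
  the left determinants satisfy the transposed equation. Differentiating this equation at an
  eigenvalue gives the normalization of the left and right eigenvectors, so these form
  biorthogonal bases and diagonalize \<open>T\<^sup>[\<^sup>N\<^sup>]\<close>.
\<close>

section \<open>Sign changes under bidiagonal maps\<close>

text \<open>Zeros leave this state untouched, so \<open>sign_changes\<close> compares consecutive
  nonzero entries. The value 0 means that no nonzero entry has occurred yet.\<close>

primrec last_sgn :: "(nat \<Rightarrow> real) \<Rightarrow> nat \<Rightarrow> real" where
  "last_sgn x 0 = 0"
| "last_sgn x (Suc n) = (if x n = 0 then last_sgn x n else sgn (x n))"

primrec sign_changes :: "(nat \<Rightarrow> real) \<Rightarrow> nat \<Rightarrow> nat" where
  "sign_changes x 0 = 0"
| "sign_changes x (Suc n) = sign_changes x n + (if last_sgn x n * x n < 0 then 1 else 0)"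

lemma last_sgn_cases: "last_sgn x n = 0 \<or> last_sgn x n = 1 \<or> last_sgn x n = -1"
  by (induction n) (auto simp: sgn_if)

lemma last_sgn_eq_0_iff: "last_sgn x n = 0 \<longleftrightarrow> (\<forall>i<n. x i = 0)"
  by (induction n) (auto simp: less_Suc_eq sgn_zero_iff)

lemma last_sgn_cong: "(\<And>i. i < n \<Longrightarrow> x i = y i) \<Longrightarrow> last_sgn x n = last_sgn y n"
  by (induction n) auto

lemma sign_changes_cong: "(\<And>i. i < n \<Longrightarrow> x i = y i) \<Longrightarrow> sign_changes x n = sign_changes y n"
  by (induction n) (auto simp: last_sgn_cong[of _ x y])

lemma last_sgn_scale: "0 < c \<Longrightarrow> last_sgn (\<lambda>i. c * x i) n = last_sgn x n"
  by (induction n) (auto simp: sgn_mult)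

lemma sign_changes_scale: "0 < c \<Longrightarrow> sign_changes (\<lambda>i. c * x i) n = sign_changes x n"
  by (induction n) (auto simp: last_sgn_scale mult_less_0_iff zero_less_mult_iff)

definition lower_act :: "smat \<Rightarrow> (nat \<Rightarrow> real) \<Rightarrow> nat \<Rightarrow> real" where
  "lower_act L x n = L n n * x n + (case n of 0 \<Rightarrow> 0 | Suc i \<Rightarrow> L n i * x i)"

definition upper_act :: "smat \<Rightarrow> (nat \<Rightarrow> real) \<Rightarrow> nat \<Rightarrow> real" where
  "upper_act U x n = U n n * x n + U n (Suc n) * x (Suc n)"

text \<open>The induction step of \<open>sign_changes_bidiagonal\<close> with all entries replaced
  by their signs, which leaves a finite case check. Here \<open>s\<close> and \<open>t\<close> are
  the last signs of input and output, \<open>x\<close> and \<open>y\<close> the signs of their next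
  entries, \<open>l\<close> and \<open>k\<close> the two counts.\<close>

lemma bidiagonal_sign_step:
  fixes s t x y :: real and k l :: nat
  assumes "s = 0 \<or> s = 1 \<or> s = -1" and "t = 0 \<or> t = 1 \<or> t = -1" and "s = 0 \<Longrightarrow> t = 0"
    and "x = 0 \<or> x = 1 \<or> x = -1" and "y = 0 \<or> y = 1 \<or> y = -1"
    and "0 \<le> s * x \<Longrightarrow> y = 0 \<or> y = (if x = 0 then s else x)"
    and "k + (if t * s < 0 then 1 else 0) \<le> l"
  shows "k + (if t * y < 0 then 1 else 0)
      + (if (if y = 0 then t else y) * (if x = 0 then s else x) < 0 then 1 else 0)
    \<le> l + (if s * x < 0 then 1 else 0)"
  using assms by (elim disjE) simp_all

text \<open>The extra summand makes the induction work: a change in \<open>x\<close> may reach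
  \<open>y\<close> one step late, and while the two last signs disagree \<open>y\<close> is at least
  one change behind.\<close>

lemma sign_changes_bidiagonal:
  assumes a: "\<And>n. 0 \<le> a n" and b: "\<And>n. 0 \<le> b n"
    and y: "\<And>n. y n = a n * x n + (case n of 0 \<Rightarrow> 0 | Suc i \<Rightarrow> b n * x i)"
  shows "sign_changes y n + (if last_sgn y n * last_sgn x n < 0 then 1 else 0) \<le> sign_changes x n"
proof (induction n)
  case 0
  then show ?case by simp
next
  case (Suc n)
  define s where "s = last_sgn x n"
  define t where "t = last_sgn y n"
  have s: "s = 0 \<or> s = 1 \<or> s = -1" and t: "t = 0 \<or> t = 1 \<or> t = -1"
    unfolding s_def t_def by (rule last_sgn_cases)+
  have t0: "t = 0" if "s = 0"
  proof -
    from that have "\<forall>i<n. x i = 0" by (simp add: s_def last_sgn_eq_0_iff)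
    then have "\<forall>i<n. y i = 0" by (auto simp: y split: nat.split)
    then show ?thesis by (simp add: t_def last_sgn_eq_0_iff)
  qed
  define d where "d = (case n of 0 \<Rightarrow> 0 | Suc i \<Rightarrow> b n * x i)"
  have yn: "y n = a n * x n + d" by (simp add: y d_def)
  \<comment> \<open>The preceding entry of \<open>x\<close> is either zero or determines the last
    sign \<open>s\<close>, so its contribution \<open>d\<close> never opposes
    \<open>s\<close>.\<close>
  have d: "0 \<le> s * d \<and> (s = 0 \<longrightarrow> d = 0)"
  proof (cases n)
    case 0
    then show ?thesis by (simp add: d_def)
  next
    case (Suc i)
    show ?thesis
    proof (cases "x i = 0")
      case True
      then show ?thesis by (simp add: d_def Suc)
    next
      case False
      then have "s = sgn (x i)" by (simp add: s_def Suc)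
      with False b[of n] show ?thesis
        by (auto simp: d_def Suc sgn_if mult_nonneg_nonneg mult_nonneg_nonpos)
    qed
  qed
  have ay: "x n = 0 \<Longrightarrow> y n = d" "x n > 0 \<Longrightarrow> y n \<ge> d" "x n < 0 \<Longrightarrow> y n \<le> d"
    using a[of n] by (auto simp: yn mult_nonneg_nonneg mult_nonneg_nonpos)
  have key: "y n = 0 \<or> sgn (y n) = (if x n = 0 then s else sgn (x n))" if "0 \<le> s * x n"
  proof (cases "x n" "0::real" rule: linorder_cases)
    case less
    with that s d have "d \<le> 0" by auto
    with less ay(3) show ?thesis by (auto simp: sgn_if)
  next
    case equal
    with s d ay(1) show ?thesis by (auto simp: sgn_if)
  next
    case greater
    with that s d have "0 \<le> d" by auto
    with greater ay(2) show ?thesis by (auto simp: sgn_if)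
  qed
  have *: "sgn z = 0 \<or> sgn z = 1 \<or> sgn z = -1" for z :: real by (simp add: sgn_if)
  have **: "s * sgn z < 0 \<longleftrightarrow> s * z < 0" "0 \<le> s * sgn z \<longleftrightarrow> 0 \<le> s * z" for s z :: real
    by (auto simp: sgn_if mult_less_0_iff zero_le_mult_iff)
  show ?case
    using bidiagonal_sign_step[OF s t t0 *[of "x n"] *[of "y n"],
        of "sign_changes y n" "sign_changes x n"] key Suc.IH
    by (simp only: sign_changes.simps last_sgn.simps s_def[symmetric] t_def[symmetric] **
        sgn_eq_0_iff simp_thms if_distrib[of "\<lambda>x. x * _ < 0"])
qed

text \<open>A positive diagonal keeps the first nonzero entry in its place.\<close>

lemma last_sgn_lower_act_eq_0_iff:
  assumes "pos_lower_bidiagonal L"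
  shows "last_sgn (lower_act L x) n = 0 \<longleftrightarrow> last_sgn x n = 0"
proof -
  have "L i i > 0" for i using assms unfolding pos_lower_bidiagonal_def by (metis (full_types))
  then have "lower_act L x i = 0 \<longleftrightarrow> x i = 0" if "\<forall>j<i. x j = 0" for i
    using that by (cases i) (auto simp: lower_act_def less_imp_neq[symmetric] dest: spec[of _ i])
  then have "(\<forall>i<n. lower_act L x i = 0) \<longleftrightarrow> (\<forall>i<n. x i = 0)"
    by (induction n) (auto simp: less_Suc_eq)
  then show ?thesis by (simp add: last_sgn_eq_0_iff)
qed

lemma lower_coeffs:
  assumes "pos_lower_bidiagonal L"
  shows "0 < L n n" "0 < L (Suc n) n" "n \<noteq> m \<Longrightarrow> n \<noteq> Suc m \<Longrightarrow> L n m = 0"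
  using assms unfolding pos_lower_bidiagonal_def by (metis (full_types))+

lemma upper_coeffs:
  assumes "pos_upper_bidiagonal U"
  shows "0 < U n n" "0 < U n (Suc n)" "n \<noteq> m \<Longrightarrow> m \<noteq> Suc n \<Longrightarrow> U n m = 0"
  using assms unfolding pos_upper_bidiagonal_def by (metis (full_types))+

lemma sign_changes_lower_act:
  assumes "pos_lower_bidiagonal L"
  shows "sign_changes (lower_act L x) n
    + (if last_sgn (lower_act L x) n * last_sgn x n < 0 then 1 else 0) \<le> sign_changes x n"
proof (rule sign_changes_bidiagonal)
  show "lower_act L x n = (L n n) * x n + (case n of 0 \<Rightarrow> 0 | Suc i \<Rightarrow> L n (n - 1) * x i)" for n
    by (simp add: lower_act_def split: nat.split)
  show "0 \<le> L n n" for n using lower_coeffs(1)[OF assms, of n] by simp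
  \<comment> \<open>At \<open>n = 0\<close> truncated subtraction yields \<open>L 0 0\<close>; it
    multiplies nothing there, but the general bound asks for its sign.\<close>
  show "0 \<le> L n (n - 1)" for n
    using lower_coeffs(1)[OF assms, of 0] lower_coeffs(2)[OF assms, of "n - 1"] by (cases n) auto
qed

text \<open>Shifting the image by one index turns an upper bidiagonal map into a lower bidiagonal one
  with some vanishing coefficients.\<close>

lemma sign_changes_upper_act:
  assumes U: "pos_upper_bidiagonal U" and x: "x n = 0"
  shows "sign_changes (upper_act U x) n \<le> sign_changes x n"
proof -
  define y where "y = (\<lambda>n. case n of 0 \<Rightarrow> 0 | Suc i \<Rightarrow> upper_act U x i)"
  have shift: "sign_changes y (Suc n) = sign_changes (upper_act U x) n \<and>
      last_sgn y (Suc n) = last_sgn (upper_act U x) n" for n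
    by (induction n) (auto simp: y_def)
  have "sign_changes y (Suc n)
    + (if last_sgn y (Suc n) * last_sgn x (Suc n) < 0 then 1 else 0) \<le> sign_changes x (Suc n)"
  proof (rule sign_changes_bidiagonal)
    show "y n = (case n of 0 \<Rightarrow> 0 | Suc i \<Rightarrow> U i n) * x n
        + (case n of 0 \<Rightarrow> 0 | Suc i \<Rightarrow> U (n - 1) (n - 1) * x i)" for n
      by (simp add: y_def upper_act_def split: nat.split)
    show "0 \<le> (case n of 0 \<Rightarrow> 0 | Suc i \<Rightarrow> U i n)" for n
      using upper_coeffs(2)[OF U] by (auto simp: less_imp_le split: nat.split)
    show "0 \<le> U (n - 1) (n - 1)" for n
      using upper_coeffs(1)[OF U] by (simp add: less_imp_le)
  qed
  \<comment> \<open>The shift lengthens the window by one entry, and \<open>x n = 0\<close> adds no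
    change to \<open>x\<close> there.\<close>
  then show ?thesis using shift[of n] x by simp
qed

text \<open>A zero at position \<open>N\<close> also counts as a change, so the count can drop when
  that zero acquires the sign of the last nonzero entry before it.\<close>

definition sign_changes' :: "(nat \<Rightarrow> real) \<Rightarrow> nat \<Rightarrow> nat" where
  "sign_changes' x N = sign_changes x N + (if last_sgn x N * x N > 0 then 0 else 1)"

text \<open>If the last sign of the image has flipped, the extra summand in
  \<open>sign_changes_lower_act\<close> pays for a change at the final entry. In the second part the
  zero entry becomes \<open>L (Suc N) N * x N\<close>, which has the sign of \<open>x N\<close>, so
  the change counted for the zero disappears.\<close>

lemma sign_changes'_lower_act:
  assumes L: "pos_lower_bidiagonal L"
  shows "sign_changes' (lower_act L x) N \<le> sign_changes' x N"
    and "last_sgn x (Suc N) \<noteq> 0 \<Longrightarrow> x N \<noteq> 0 \<Longrightarrow> x (Suc N) = 0 \<Longrightarrow>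
      sign_changes' (lower_act L x) (Suc N) < sign_changes' x (Suc N)"
proof -
  define y where "y = lower_act L x"
  have *: "sign_changes y n + (if last_sgn y n * last_sgn x n < 0 then 1 else 0)
      \<le> sign_changes x n" and z: "last_sgn y n = 0 \<longleftrightarrow> last_sgn x n = 0" for n
    unfolding y_def by (rule sign_changes_lower_act[OF L], rule last_sgn_lower_act_eq_0_iff[OF L])
  have yN: "y N * last_sgn x N > 0" if "last_sgn x N * x N > 0"
  proof -
    have a: "L N N * (x N * last_sgn x N) > 0"
      using that lower_coeffs(1)[OF L] by (simp add: mult.commute)
    have b: "(case N of 0 \<Rightarrow> 0 | Suc i \<Rightarrow> L N i * x i) * last_sgn x N \<ge> 0"
    proof (cases N)
      case (Suc i)
      have "L N i > 0" using lower_coeffs(2)[OF L] Suc by simp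
      then have "L N i * (x i * sgn (x i)) \<ge> 0" by (simp add: sgn_if)
      then show ?thesis using Suc by (auto simp: algebra_simps)
    qed simp
    show ?thesis unfolding y_def lower_act_def using a b by (simp add: algebra_simps)
  qed
  show "sign_changes' (lower_act L x) N \<le> sign_changes' x N"
    using *[of N] z[of N] yN last_sgn_cases[of x N] last_sgn_cases[of y N]
    unfolding sign_changes'_def y_def[symmetric]
    by (elim disjE; simp split: if_splits)
  assume x: "last_sgn x (Suc N) \<noteq> 0" "x N \<noteq> 0" "x (Suc N) = 0"
  have "y (Suc N) = L (Suc N) N * x N" using x by (simp add: y_def lower_act_def)
  then have "y (Suc N) * last_sgn x (Suc N) > 0"
    using x lower_coeffs(2)[OF L, of N] by (simp add: sgn_if mult_pos_neg)
  then show "sign_changes' (lower_act L x) (Suc N) < sign_changes' x (Suc N)"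
    using *[of "Suc N"] z[of "Suc N"] x last_sgn_cases[of x "Suc N"] last_sgn_cases[of y "Suc N"]
    unfolding sign_changes'_def y_def[symmetric]
    by (elim disjE; simp del: last_sgn.simps sign_changes.simps split: if_splits)
qed

text \<open>Positive diagonals keep the last nonzero entry at position \<open>N\<close>, so the zero
  required by \<open>sign_changes_upper_act\<close> is available for every factor.\<close>

lemma foldr_upper_act:
  assumes "\<And>U. U \<in> set Us \<Longrightarrow> pos_upper_bidiagonal U"
    and "x N \<noteq> 0" and "\<And>i. N < i \<Longrightarrow> x i = 0"
  shows "foldr upper_act Us x N \<noteq> 0 \<and> (\<forall>i>N. foldr upper_act Us x i = 0) \<and>
    sign_changes (foldr upper_act Us x) (Suc N) \<le> sign_changes x (Suc N)"
  using assms(1)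
proof (induction Us)
  case Nil
  then show ?case using assms by simp
next
  case (Cons U Us)
  define z where "z = foldr upper_act Us x"
  have IH: "z N \<noteq> 0" "\<forall>i>N. z i = 0" "sign_changes z (Suc N) \<le> sign_changes x (Suc N)"
    using Cons unfolding z_def by auto
  have U: "pos_upper_bidiagonal U" using Cons.prems by simp
  have "upper_act U z N \<noteq> 0" using IH upper_coeffs(1)[OF U, of N] by (simp add: upper_act_def)
  moreover have "\<forall>i>N. upper_act U z i = 0" using IH by (simp add: upper_act_def)
  moreover have "sign_changes (upper_act U z) (Suc N) \<le> sign_changes z (Suc N)"
    by (rule sign_changes_upper_act[OF U]) (use IH in simp)
  ultimately show ?case using IH unfolding z_def by simp
qed

text \<open>The factor applied first gives the strict drop, since only there the entry at
  \<open>Suc N\<close> is known to vanish; the later factors do not increase the count.\<close>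

lemma foldr_lower_act:
  assumes "\<And>L. L \<in> set Ls \<Longrightarrow> pos_lower_bidiagonal L"
    and "x N \<noteq> 0" and "x (Suc N) = 0" and "Ls \<noteq> []"
  shows "sign_changes' (foldr lower_act Ls x) (Suc N) < sign_changes' x (Suc N)"
  using assms(1,4)
proof (induction Ls)
  case (Cons L Ls)
  have L: "pos_lower_bidiagonal L" using Cons.prems by simp
  show ?case
  proof (cases "Ls = []")
    case True
    then show ?thesis using sign_changes'_lower_act(2)[OF L, of x N] assms
      by (simp add: sgn_zero_iff)
  next
    case False
    have "sign_changes' (lower_act L (foldr lower_act Ls x)) (Suc N)
        \<le> sign_changes' (foldr lower_act Ls x) (Suc N)"
      by (rule sign_changes'_lower_act(1)[OF L])
    also have "\<dots> < sign_changes' x (Suc N)" using Cons False by simp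
    finally show ?thesis by simp
  qed
qed simp

section \<open>Products of bidiagonal matrices\<close>

text \<open>A class that contains both kinds of bidiagonal matrices and is closed under
  transposition. A factor of this kind makes the sums in a product finite.\<close>

definition tridiagonal :: "smat \<Rightarrow> bool" where
  "tridiagonal X \<longleftrightarrow> (\<forall>n m. Suc n < m \<or> Suc m < n \<longrightarrow> X n m = 0)"

lemma lower_tridiagonal: "pos_lower_bidiagonal L \<Longrightarrow> tridiagonal L"
  unfolding tridiagonal_def using lower_coeffs(3) by auto

lemma upper_tridiagonal: "pos_upper_bidiagonal U \<Longrightarrow> tridiagonal U"
  unfolding tridiagonal_def using upper_coeffs(3) by auto

lemma Sum_any_eq_sum:
  assumes "finite S" and "\<And>l. l \<notin> S \<Longrightarrow> f l = 0"
  shows "Sum_any f = sum f S"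
  by (rule Sum_any.expand_superset) (use assms in auto)

lemma smat_mult_tridiagonal:
  assumes "tridiagonal X"
  shows "smat_mult X Y n m = (\<Sum>l\<le>Suc n. X n l * Y l m)"
  unfolding smat_mult_def
  by (rule Sum_any_eq_sum) (use assms in \<open>auto simp: tridiagonal_def\<close>)

lemma smat_prod_list_Cons: "smat_prod_list (X # Xs) = smat_mult X (smat_prod_list Xs)"
  by (simp add: smat_prod_list_def)

text \<open>Products are built from the left, while transposition reverses the order, so the
  rightmost factor must be split off too. Tridiagonality bounds both sums, which can then be
  interchanged.\<close>

lemma smat_prod_list_snoc:
  assumes "\<And>X. X \<in> set Xs \<Longrightarrow> tridiagonal X" and Y: "tridiagonal Y"
  shows "smat_prod_list (Xs @ [Y]) n m = (\<Sum>l\<le>Suc m. smat_prod_list Xs n l * Y l m)"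
  using assms(1)
proof (induction Xs arbitrary: n)
  case Nil
  have "smat_prod_list [Y] n m = (\<Sum>l\<le>Suc n. Y n l * (if l = m then 1 else 0))"
    by (simp add: smat_prod_list_Cons smat_mult_tridiagonal[OF Y])
       (simp add: smat_prod_list_def smat_one_def)
  also have "\<dots> = (if m \<le> Suc n then Y n m else 0)" by (simp add: if_distrib cong: if_cong)
  also have "\<dots> = Y n m" using Y by (auto simp: tridiagonal_def)
  also have "\<dots> = (if n \<le> Suc m then Y n m else 0)" using Y by (auto simp: tridiagonal_def)
  also have "\<dots> = (\<Sum>l\<le>Suc m. (if n = l then 1 else 0) * Y l m)"
    by (simp add: if_distrib[of "\<lambda>x. x * _"] cong: if_cong)
  finally show ?case by (simp add: smat_prod_list_def smat_one_def)
next
  case (Cons X Xs)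
  have X: "tridiagonal X" using Cons.prems by simp
  have "smat_prod_list ((X # Xs) @ [Y]) n m
      = (\<Sum>k\<le>Suc n. X n k * (\<Sum>l\<le>Suc m. smat_prod_list Xs k l * Y l m))"
    using Cons by (simp add: smat_prod_list_Cons smat_mult_tridiagonal[OF X])
  also have "\<dots> = (\<Sum>l\<le>Suc m. (\<Sum>k\<le>Suc n. X n k * smat_prod_list Xs k l) * Y l m)"
    by (simp only: sum_distrib_left sum_distrib_right mult.assoc) (rule sum.swap)
  finally show ?case by (simp add: smat_prod_list_Cons smat_mult_tridiagonal[OF X])
qed

section \<open>Transposition of products\<close>

definition smat_transpose :: "smat \<Rightarrow> smat" where
  "smat_transpose X = (\<lambda>n m. X m n)"

lemma smat_transpose_apply: "smat_transpose X n m = X m n"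
  by (simp add: smat_transpose_def)

lemma transpose_tridiagonal: "tridiagonal X \<Longrightarrow> tridiagonal (smat_transpose X)"
  unfolding tridiagonal_def smat_transpose_def by auto

lemma smat_prod_list_transpose:
  assumes "\<And>X. X \<in> set Xs \<Longrightarrow> tridiagonal X"
  shows "smat_prod_list (rev (map smat_transpose Xs)) = smat_transpose (smat_prod_list Xs)"
  using assms
proof (induction Xs)
  case Nil
  then show ?case by (auto simp: smat_prod_list_def smat_one_def smat_transpose_def fun_eq_iff)
next
  case (Cons X Xs)
  show ?case
  proof (intro ext)
    fix n m
    have "smat_prod_list (rev (map smat_transpose (X # Xs))) n m
      = (\<Sum>l\<le>Suc m. smat_transpose (smat_prod_list Xs) n l * smat_transpose X l m)"
      using Cons by (simp, subst smat_prod_list_snoc) (auto simp: transpose_tridiagonal)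
    also have "\<dots> = smat_transpose (smat_prod_list (X # Xs)) n m"
      using Cons.prems
      by (simp add: smat_prod_list_Cons smat_transpose_def smat_mult_tridiagonal mult.commute)
    finally show "smat_prod_list (rev (map smat_transpose (X # Xs))) n m =
        smat_transpose (smat_prod_list (X # Xs)) n m" .
  qed
qed

section \<open>Action of a product on finitely supported sequences\<close>

definition act :: "smat \<Rightarrow> (nat \<Rightarrow> real) \<Rightarrow> nat \<Rightarrow> real" where
  "act X x n = (\<Sum>l\<le>Suc n. X n l * x l)"

lemma act_lower: "pos_lower_bidiagonal L \<Longrightarrow> act L x = lower_act L x"
proof
  fix n
  assume L: "pos_lower_bidiagonal L"
  show "act L x n = lower_act L x n"
  proof (cases n)
    case 0
    then show ?thesis using lower_coeffs(3)[OF L, of 0 "Suc 0"] by (simp add: act_def lower_act_def)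
  next
    case (Suc i)
    have "(\<Sum>l\<le>Suc n. L n l * x l) = (\<Sum>l\<in>{i, n}. L n l * x l)"
      by (rule sum.mono_neutral_right) (use Suc lower_coeffs(3)[OF L] in auto)
    then show ?thesis using Suc by (simp add: act_def lower_act_def)
  qed
qed

lemma act_upper: "pos_upper_bidiagonal U \<Longrightarrow> act U x = upper_act U x"
proof
  fix n
  assume U: "pos_upper_bidiagonal U"
  have "(\<Sum>l\<le>Suc n. U n l * x l) = (\<Sum>l\<in>{n, Suc n}. U n l * x l)"
    by (rule sum.mono_neutral_right) (use upper_coeffs(3)[OF U] in auto)
  then show "act U x n = upper_act U x n" by (simp add: act_def upper_act_def)
qed

text \<open>Cutting \<open>x\<close> off after \<open>N\<close> entries turns the truncated row sum
  into a full matrix product, which is evaluated factor by factor.\<close>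

lemma smat_prod_list_act:
  assumes "\<And>X. X \<in> set Xs \<Longrightarrow> tridiagonal X"
  shows "(\<Sum>l<N. smat_prod_list Xs n l * x l) = foldr act Xs (\<lambda>i. if i < N then x i else 0) n"
  using assms
proof (induction Xs arbitrary: n)
  case Nil
  have "(\<Sum>l<N. (if n = l then 1 else 0) * x l) = (if n < N then x n else 0)"
    by (simp add: if_distrib[of "\<lambda>x. x * _"] cong: if_cong)
  then show ?case by (simp add: smat_prod_list_def smat_one_def)
next
  case (Cons X Xs)
  have X: "tridiagonal X" using Cons.prems by simp
  have "(\<Sum>l<N. smat_prod_list (X # Xs) n l * x l)
      = (\<Sum>l<N. (\<Sum>k\<le>Suc n. X n k * smat_prod_list Xs k l) * x l)"
    by (simp add: smat_prod_list_Cons smat_mult_tridiagonal[OF X])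
  also have "\<dots> = (\<Sum>k\<le>Suc n. X n k * (\<Sum>l<N. smat_prod_list Xs k l * x l))"
    by (simp only: sum_distrib_left sum_distrib_right mult.assoc) (rule sum.swap)
  finally show ?case using Cons by (simp add: act_def)
qed

lemma foldr_act_bidiagonal:
  assumes "\<And>L. L \<in> set Ls \<Longrightarrow> pos_lower_bidiagonal L"
    and "\<And>U. U \<in> set Us \<Longrightarrow> pos_upper_bidiagonal U"
  shows "foldr act (Ls @ Us) x = foldr lower_act Ls (foldr upper_act Us x)"
proof -
  have "foldr act Us x = foldr upper_act Us x" using assms(2)
    by (induction Us) (auto simp: act_upper)
  moreover have "foldr act Ls z = foldr lower_act Ls z" for z using assms(1)
    by (induction Ls) (auto simp: act_lower)
  ultimately show ?thesis by simp
qed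

text \<open>Lists in place of numbered factors make the property visibly stable under transposition,
  which reverses the product and exchanges the two kinds. Left eigenvectors are then handled through
  the transposed matrix.\<close>

definition pos_LU_product :: "smat \<Rightarrow> bool" where
  "pos_LU_product T \<longleftrightarrow> (\<exists>Ls Us. Ls \<noteq> [] \<and> Us \<noteq> [] \<and> (\<forall>L\<in>set Ls. pos_lower_bidiagonal L) \<and>
     (\<forall>U\<in>set Us. pos_upper_bidiagonal U) \<and> T = smat_prod_list (Ls @ Us))"

lemma has_pos_bidiagonal_factorization_imp_LU:
  assumes "has_pos_bidiagonal_factorization p q T" and "1 \<le> p" and "1 \<le> q"
  shows "pos_LU_product T"
proof -
  obtain L U where *: "\<forall>i\<in>{1..p}. pos_lower_bidiagonal (L i)" "\<forall>j\<in>{1..q}. pos_upper_bidiagonal (U j)"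
    "T = smat_prod_list (map L [1..<Suc p] @ map U (rev [1..<Suc q]))"
    using assms(1) unfolding has_pos_bidiagonal_factorization_def by blast
  show ?thesis unfolding pos_LU_product_def
    by (rule exI[of _ "map L [1..<Suc p]"], rule exI[of _ "map U (rev [1..<Suc q])"])
       (use * assms(2,3) in auto)
qed

lemma pos_LU_product_transpose:
  assumes "pos_LU_product T"
  shows "pos_LU_product (smat_transpose T)"
proof -
  obtain Ls Us where *: "Ls \<noteq> []" "Us \<noteq> []" "\<forall>L\<in>set Ls. pos_lower_bidiagonal L"
    "\<forall>U\<in>set Us. pos_upper_bidiagonal U" "T = smat_prod_list (Ls @ Us)"
    using assms unfolding pos_LU_product_def by blast
  have "pos_upper_bidiagonal (smat_transpose L)" if "pos_lower_bidiagonal L" for L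
    using that unfolding pos_upper_bidiagonal_def pos_lower_bidiagonal_def smat_transpose_def by metis
  moreover have "pos_lower_bidiagonal (smat_transpose L)" if "pos_upper_bidiagonal L" for L
    using that unfolding pos_upper_bidiagonal_def pos_lower_bidiagonal_def smat_transpose_def by metis
  moreover have "smat_transpose T = smat_prod_list (rev (map smat_transpose (Ls @ Us)))"
    unfolding *(5)
    by (rule smat_prod_list_transpose[symmetric]) (use * lower_tridiagonal upper_tridiagonal in auto)
  ultimately show ?thesis unfolding pos_LU_product_def using *
    by (intro exI[of _ "rev (map smat_transpose Us)"] exI[of _ "rev (map smat_transpose Ls)"]) auto
qed

text \<open>A zero or a wrong sign in the new component would contradict the strict decrease of the
  number of sign changes along the product.\<close>

lemma eigenvector_next_component_sign:
  assumes T: "pos_LU_product T" and mu: "0 < \<mu>" and v: "v N \<noteq> 0"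
    and eig: "\<And>n. n \<le> N \<Longrightarrow> (\<Sum>l\<le>N. T n l * v l) = \<mu> * v n"
  shows "0 < v N * (\<Sum>l\<le>N. T (Suc N) l * v l)"
proof -
  obtain Ls Us where *: "Ls \<noteq> []" "\<And>L. L \<in> set Ls \<Longrightarrow> pos_lower_bidiagonal L"
    "\<And>U. U \<in> set Us \<Longrightarrow> pos_upper_bidiagonal U" "T = smat_prod_list (Ls @ Us)"
    using T unfolding pos_LU_product_def by blast
  define x where "x i = (if i < Suc N then v i else 0)" for i
  define z where "z = foldr upper_act Us x"
  define y where "y = foldr lower_act Ls z"
  have yT: "y n = (\<Sum>l\<le>N. T n l * v l)" for n
  proof -
    have "(\<Sum>l<Suc N. T n l * v l) = foldr act (Ls @ Us) x n"
      unfolding *(4) x_def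
      by (rule smat_prod_list_act) (use * lower_tridiagonal upper_tridiagonal in auto)
    then show ?thesis unfolding y_def z_def using foldr_act_bidiagonal[OF *(2,3)]
      by (simp add: lessThan_Suc_atMost)
  qed
  have y: "y n = \<mu> * v n" if "n < Suc N" for n using that eig yT by simp
  have zN: "z N \<noteq> 0" "z (Suc N) = 0" "sign_changes z (Suc N) \<le> sign_changes x (Suc N)"
    using foldr_upper_act[of Us x N] * v unfolding z_def x_def by auto
  \<comment> \<open>The chain bounds \<open>sign_changes'\<close> of \<open>y\<close> by its plain
    count, so the last summand in \<open>sign_changes'\<close> is zero: \<open>y (Suc N)\<close> has
    the sign of its last nonzero predecessor, which is that of \<open>v N\<close>.\<close>
  have "sign_changes' y (Suc N) < sign_changes' z (Suc N)"
    unfolding y_def by (rule foldr_lower_act[OF *(2) zN(1,2) *(1)])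
  also have "\<dots> \<le> Suc (sign_changes x (Suc N))" using zN by (simp add: sign_changes'_def)
  \<comment> \<open>On the first \<open>Suc N\<close> entries \<open>y\<close> is the positive
    multiple \<mu> of \<open>x\<close>; this closes the circle.\<close>
  also have "sign_changes x (Suc N) = sign_changes y (Suc N)"
    using y sign_changes_scale[OF mu, of v "Suc N"] sign_changes_cong[of "Suc N" y "\<lambda>i. \<mu> * v i"]
      sign_changes_cong[of "Suc N" x v] by (simp add: x_def)
  finally have "last_sgn y (Suc N) * y (Suc N) > 0"
    by (simp add: sign_changes'_def del: last_sgn.simps sign_changes.simps split: if_splits)
  moreover have "last_sgn y (Suc N) = sgn (v N)" using y[of N] mu v by (simp add: sgn_mult)
  ultimately show ?thesis using yT v by (simp add: sgn_if zero_less_mult_iff split: if_splits)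
qed

section \<open>Truncations\<close>

lemma trunc_carrier [simp]: "trunc T N \<in> carrier_mat (Suc N) (Suc N)"
  by (simp add: trunc_def)

lemma trunc_index: "i \<le> N \<Longrightarrow> j \<le> N \<Longrightarrow> trunc T N $$ (i, j) = T i j"
  by (simp add: trunc_def)

lemma trunc_transpose: "trunc (smat_transpose T) N = transpose_mat (trunc T N)"
  by (rule eq_matI) (auto simp: trunc_def smat_transpose_def)

lemma charP_transpose: "charP (smat_transpose T) M = charP T M"
  by (cases M) (simp_all add: charP_def trunc_transpose char_poly_transpose_mat[OF trunc_carrier])

text \<open>Row \<open>i\<close> of a lower triangular factor reaches no index beyond
  \<open>i\<close>, so truncation loses no term of the product.\<close>

lemma trunc_mult_lower:
  assumes L: "pos_lower_bidiagonal L"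
  shows "trunc (smat_mult L Y) N = trunc L N * trunc Y N"
proof (rule eq_matI)
  fix i j
  assume "i < dim_row (trunc L N * trunc Y N)" and "j < dim_col (trunc L N * trunc Y N)"
  then have ij: "i \<le> N" "j \<le> N" by (auto simp: trunc_def)
  have "(trunc L N * trunc Y N) $$ (i, j) = (\<Sum>l<Suc N. L i l * Y l j)"
    using ij by (simp add: trunc_def scalar_prod_def atLeast0LessThan)
  also have "\<dots> = (\<Sum>l\<le>i. L i l * Y l j)"
    by (rule sum.mono_neutral_right) (use ij lower_coeffs(3)[OF L] in auto)
  also have "\<dots> = (\<Sum>l\<le>Suc i. L i l * Y l j)"
    by (rule sum.mono_neutral_left) (use lower_coeffs(3)[OF L] in auto)
  finally show "trunc (smat_mult L Y) N $$ (i, j) = (trunc L N * trunc Y N) $$ (i, j)"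
    using ij by (simp add: trunc_index smat_mult_tridiagonal[OF lower_tridiagonal[OF L]])
qed (auto simp: trunc_def)

lemma upper_product:
  assumes "\<And>U. U \<in> set Us \<Longrightarrow> pos_upper_bidiagonal U"
  shows "(m < n \<longrightarrow> smat_prod_list Us n m = 0) \<and> 0 < smat_prod_list Us n n"
  using assms
proof (induction Us arbitrary: n m)
  case Nil
  then show ?case by (simp add: smat_prod_list_def smat_one_def)
next
  case (Cons U Us)
  have U: "pos_upper_bidiagonal U" using Cons.prems by simp
  have "smat_prod_list (U # Us) n m
      = U n n * smat_prod_list Us n m + U n (Suc n) * smat_prod_list Us (Suc n) m" for n m
    using fun_cong[OF act_upper[OF U, of "\<lambda>l. smat_prod_list Us l m"], of n]
    by (simp add: smat_prod_list_Cons smat_mult_tridiagonal[OF upper_tridiagonal[OF U]]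
        act_def upper_act_def)
  then show ?case using Cons upper_coeffs(1)[OF U] by auto
qed

text \<open>The lower factors are split off from the left by \<open>trunc_mult_lower\<close>; what
  remains is upper triangular with positive diagonal.\<close>

lemma det_trunc_pos:
  assumes "pos_LU_product T"
  shows "0 < det (trunc T N)"
proof -
  obtain Ls Us where *: "\<And>L. L \<in> set Ls \<Longrightarrow> pos_lower_bidiagonal L"
    "\<And>U. U \<in> set Us \<Longrightarrow> pos_upper_bidiagonal U" "T = smat_prod_list (Ls @ Us)"
    using assms unfolding pos_LU_product_def by blast
  have "0 < det (trunc (smat_prod_list (Ls @ Us)) N)" using *(1)
  proof (induction Ls)
    case Nil
    have "det (trunc (smat_prod_list Us) N) = (\<Prod>i = 0..<Suc N. smat_prod_list Us i i)"
      by (subst det_upper_triangular[OF upper_triangularI trunc_carrier])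
         (auto simp: trunc_def upper_product[OF *(2)] prod_list_diag_prod)
    then show ?case using upper_product[OF *(2)] by (simp add: prod_pos)
  next
    case (Cons L Ls)
    have L: "pos_lower_bidiagonal L" using Cons.prems by simp
    have "det (trunc L N) = (\<Prod>i = 0..<Suc N. L i i)"
      by (subst det_lower_triangular[OF _ trunc_carrier])
         (auto simp: trunc_def lower_coeffs(3)[OF L] prod_list_diag_prod)
    then have "0 < det (trunc L N)" using lower_coeffs(1)[OF L] by (simp add: prod_pos)
    then show ?case using Cons
      by (simp add: smat_prod_list_Cons trunc_mult_lower[OF L] det_mult[OF trunc_carrier trunc_carrier])
  qed
  then show ?thesis using * by simp
qed

text \<open>Up to the sign \<open>(-1) ^ M\<close> the value at 0 is the determinant of the
  truncation. This fixes the sign at the leftmost node when the roots are located.\<close>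

lemma charP_at_0:
  assumes "pos_LU_product T"
  shows "0 < (-1) ^ M * poly (charP T M) 0"
proof (cases M)
  case 0
  then show ?thesis by (simp add: charP_def)
next
  case (Suc N)
  have "- char_matrix (trunc T N) 0 = (-1) \<cdot>\<^sub>m trunc T N"
    by (rule eq_matI) (auto simp: char_matrix_def trunc_def)
  then have "poly (charP T M) 0 = (-1) ^ M * det (trunc T N)"
    by (simp add: charP_def Suc char_poly_matrix[OF trunc_carrier]) (simp add: trunc_def)
  then have "(-1) ^ M * poly (charP T M) 0 = ((-1) * (-1)) ^ M * det (trunc T N)"
    by (simp only: mult.assoc power_mult_distrib)
  then show ?thesis using det_trunc_pos[OF assms] by simp
qed

lemma charP_degree: "degree (charP T M) = M \<and> coeff (charP T M) M = 1"
  using degree_monic_char_poly[OF trunc_carrier] by (cases M) (auto simp: charP_def)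

lemma charP_nonzero: "charP T M \<noteq> 0"
  using charP_degree[of T M] by auto

lemma charP_pos_at_top: "\<exists>z. \<forall>x\<ge>z. 0 < poly (charP T M) x"
proof -
  have "0 < lead_coeff (charP T M)" using charP_degree[of T M] by simp
  then obtain z where "\<forall>x\<ge>z. lead_coeff (charP T M) \<le> poly (charP T M) x"
    using poly_pinfty_gt_lc by blast
  then have "\<forall>x\<ge>z. 0 < poly (charP T M) x"
    using \<open>0 < lead_coeff (charP T M)\<close> by (blast intro: less_le_trans)
  then show ?thesis by blast
qed

section \<open>The determinants of recursion polynomials\<close>

lemma lower_unitriangular_det:
  assumes "lower_unitriangular d M"
  shows "det M = 1"
proof -
  have "M \<in> carrier_mat d d" using assms by (simp add: lower_unitriangular_def)
  then show ?thesis using assms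
    by (subst det_lower_triangular[of d]) (auto simp: lower_unitriangular_def prod_list_diag_prod)
qed

text \<open>One side of the problem. It is instantiated with \<open>T\<close>, \<open>B\<close>,
  \<open>q\<close> and, for the left polynomials, with the transpose of \<open>T\<close> and
  \<open>A\<close>, \<open>p\<close>.\<close>

locale right_recursion =
  fixes q :: nat and T :: smat and \<xi> :: "real mat" and B :: "nat \<Rightarrow> nat \<Rightarrow> real poly"
  assumes q: "1 \<le> q"
    and upper_band: "\<And>n m. n + q < m \<Longrightarrow> T n m = 0"
    and xi: "lower_unitriangular q \<xi>"
    and recursion: "right_recursion_polys q T \<xi> B"
begin

lemma B_recursion:
  assumes "b \<in> {1..q}"
  shows "[:0, 1:] * B b n = (\<Sum>l\<le>n + q. Polynomial.smult (T n l) (B b l))"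
proof -
  have "[:0, 1:] * B b n = Sum_any (\<lambda>l. Polynomial.smult (T n l) (B b l))"
    using recursion assms unfolding right_recursion_polys_def by metis
  also have "\<dots> = (\<Sum>l\<le>n + q. Polynomial.smult (T n l) (B b l))"
    by (rule Sum_any_eq_sum) (use upper_band in auto)
  finally show ?thesis .
qed

text \<open>Only the first row depends on \<open>n\<close>. Expanding along it gives cofactors
  independent of \<open>n\<close>, so the determinants inherit the linear recursion of the
  \<open>B b\<close>.\<close>

lemma rec_det_expansion:
  "\<exists>c. \<forall>n. rec_det q B n N = (\<Sum>b=1..q. c b * B b n)"
proof -
  define M where "M n = Matrix.mat q q (\<lambda>(i, j). B (Suc j) (if i = 0 then n else N + i))" for n
  define c where "c b = cofactor (M 0) 0 (b - 1)" for b
  have "rec_det q B n N = (\<Sum>b=1..q. c b * B b n)" for n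
  proof -
    have "rec_det q B n N = (\<Sum>j<q. M n $$ (0, j) * cofactor (M n) 0 j)"
      unfolding rec_det_def M_def by (rule laplace_expansion_row) (use q in auto)
    also have "\<dots> = (\<Sum>j<q. B (Suc j) n * c (Suc j))"
    proof (rule sum.cong[OF refl])
      fix j assume "j \<in> {..<q}"
      moreover have "mat_delete (M n) 0 j = mat_delete (M 0) 0 j"
        by (rule eq_matI) (auto simp: mat_delete_def M_def)
      ultimately show "M n $$ (0, j) * cofactor (M n) 0 j = B (Suc j) n * c (Suc j)"
        using q by (simp add: c_def cofactor_def) (simp add: M_def)
    qed
    also have "\<dots> = (\<Sum>b=1..q. B b n * c b)"
      using sum.shift_bounds_cl_Suc_ivl[of "\<lambda>b. B b n * c b" 0 "q - 1"] q
      by (simp add: lessThan_Suc_atMost[symmetric] atLeast0AtMost)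
    finally show ?thesis by (simp add: mult.commute)
  qed
  then show ?thesis by blast
qed

lemma rec_det_recursion:
  "[:0, 1:] * rec_det q B n N = (\<Sum>l\<le>n + q. Polynomial.smult (T n l) (rec_det q B l N))"
proof -
  obtain c where c: "\<And>n. rec_det q B n N = (\<Sum>b=1..q. c b * B b n)"
    using rec_det_expansion[of N] by blast
  have "[:0, 1:] * rec_det q B n N = (\<Sum>b=1..q. c b * ([:0, 1:] * B b n))"
    unfolding c sum_distrib_left by (rule sum.cong) (simp_all only: mult.left_commute)
  also have "\<dots> = (\<Sum>b=1..q. \<Sum>l\<le>n + q. Polynomial.smult (T n l) (c b * B b l))"
    by (rule sum.cong[OF refl], subst B_recursion) (simp_all add: sum_distrib_left)
  also have "\<dots> = (\<Sum>l\<le>n + q. \<Sum>b=1..q. Polynomial.smult (T n l) (c b * B b l))"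
    by (rule sum.swap)
  finally show ?thesis by (simp add: c smult_sum2)
qed

text \<open>The first row coincides with row \<open>n - N\<close>.\<close>

lemma rec_det_vanish:
  assumes "N < n" and "n < N + q"
  shows "rec_det q B n N = 0"
  unfolding rec_det_def
  by (rule det_identical_rows[of _ q 0 "n - N"]) (use assms q in \<open>auto intro!: eq_vecI\<close>)

text \<open>The row that starts the first determinant ends the second one; the other rows agree.\<close>

lemma rec_det_shift:
  "rec_det q B (N + q) N = (-1) ^ (q - 1) * rec_det q B (Suc N) (Suc N)"
proof -
  define M where "M = Matrix.mat q q (\<lambda>(i, j). B (Suc j) (if i = 0 then N + q else N + i))"
  define M' where "M' = Matrix.mat q q (\<lambda>(i, j). B (Suc j) (if i = 0 then Suc N else Suc N + i))"
  have "rec_det q B (N + q) N = (\<Sum>j<q. M $$ (0, j) * cofactor M 0 j)"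
    unfolding rec_det_def M_def by (rule laplace_expansion_row) (use q in auto)
  also have "\<dots> = (\<Sum>j<q. (-1) ^ (q - 1) * (M' $$ (q - 1, j) * cofactor M' (q - 1) j))"
  proof (rule sum.cong[OF refl])
    fix j assume j: "j \<in> {..<q}"
    have "mat_delete M 0 j = mat_delete M' (q - 1) j"
      by (rule eq_matI) (auto simp: mat_delete_def M_def M'_def)
    \<comment> \<open>For \<open>q = 1\<close> the last row of \<open>M'\<close> is its first one,
      with index \<open>Suc N\<close>, which is again \<open>N + q\<close>.\<close>
    moreover have "M $$ (0, j) = M' $$ (q - 1, j)"
      using j q by (cases "q = 1") (auto simp: M_def M'_def)
    moreover have "(-1) ^ (q - 1) * (-1) ^ (q - 1 + j) = ((-1) ^ j :: real poly)"
      by (simp add: power_add mult.assoc[symmetric] power_mult_distrib[symmetric])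
    ultimately show "M $$ (0, j) * cofactor M 0 j =
        (-1) ^ (q - 1) * (M' $$ (q - 1, j) * cofactor M' (q - 1) j)"
      by (simp add: cofactor_def ac_simps)
  qed
  also have "\<dots> = (-1) ^ (q - 1) * det M'"
    unfolding sum_distrib_left[symmetric]
    by (subst laplace_expansion_row[of M' q "q - 1"]) (use q in \<open>auto simp: M'_def\<close>)
  finally show ?thesis by (simp add: rec_det_def M'_def)
qed

text \<open>The component \<open>n\<close> of the right eigenvector as a polynomial, before
  evaluation at an eigenvalue. In the transposed instance it is the numerator of
  \<open>wvec\<close>.\<close>

definition U :: "nat \<Rightarrow> nat \<Rightarrow> real poly" where
  "U N n = Polynomial.smult (beta q T N) (rec_det q B n N)"

lemma U_expansion: "\<exists>c. \<forall>n. U N n = (\<Sum>b=1..q. c b * B b n)"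
proof -
  obtain c where c: "\<And>n. rec_det q B n N = (\<Sum>b=1..q. c b * B b n)"
    using rec_det_expansion[of N] by blast
  then show ?thesis
    by (intro exI[of _ "\<lambda>b. Polynomial.smult (beta q T N) (c b)"]) (simp add: U_def smult_sum2)
qed

text \<open>Beyond \<open>l = N\<close> the determinants vanish up to \<open>l = N + q\<close>. The
  coefficient of that last term is outside the band if \<open>n < N\<close>; for
  \<open>n = N\<close> it is the factor by which \<open>beta\<close> grows, and
  \<open>rec_det_shift\<close> supplies the sign.\<close>

lemma U_recursion_aux:
  assumes "n \<le> N"
  shows "[:0, 1:] * U N n
    = (\<Sum>l\<le>N. Polynomial.smult (T n l) (U N l)) + (if n = N then U (Suc N) (Suc N) else 0)"
proof -
  have "(\<Sum>l\<le>n + q. Polynomial.smult (T n l) (rec_det q B l N))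
      = (\<Sum>l\<le>N + q. Polynomial.smult (T n l) (rec_det q B l N))"
    by (rule sum.mono_neutral_left) (use assms upper_band in auto)
  also have "\<dots> = (\<Sum>l\<in>insert (N + q) {..N}. Polynomial.smult (T n l) (rec_det q B l N))"
    by (rule sum.mono_neutral_right) (auto simp: rec_det_vanish)
  also have "\<dots> = (\<Sum>l\<le>N. Polynomial.smult (T n l) (rec_det q B l N))
      + Polynomial.smult (T n (N + q)) (rec_det q B (N + q) N)"
    using q by (subst sum.insert) auto
  finally have "[:0, 1:] * U N n = (\<Sum>l\<le>N. Polynomial.smult (T n l) (U N l))
      + Polynomial.smult (beta q T N * T n (N + q)) (rec_det q B (N + q) N)"
    using rec_det_recursion[of n N]
    by (simp add: U_def smult_add_right smult_sum2 mult.commute)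
  moreover have "Polynomial.smult (beta q T N * T n (N + q)) (rec_det q B (N + q) N)
      = (if n = N then U (Suc N) (Suc N) else 0)"
  proof (cases "n = N")
    case True
    have "beta q T (Suc N) = beta q T N * T N (N + q) * (-1) ^ (q - 1)"
      by (simp add: beta_def power_add add.commute)
    moreover have "(-1) ^ k * p = Polynomial.smult ((-1) ^ k) p" for k :: nat and p :: "real poly"
      by (cases "even k") auto
    ultimately show ?thesis using True by (simp add: U_def rec_det_shift)
  next
    case False
    then show ?thesis using assms upper_band[of n "N + q"] by simp
  qed
  ultimately show ?thesis by simp
qed

text \<open>The recursion says that the characteristic matrix maps the vector of the
  \<open>U N n\<close> to a multiple of the last unit vector. Multiplying by the adjugate and
  reading off the last component gives the identity.\<close>

lemma charP_mult_U:
  "charP T (Suc N) * U N N = U (Suc N) (Suc N) * charP T N"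
proof -
  define M where "M = char_poly_matrix (trunc T N)"
  define u where "u = Matrix.vec (Suc N) (U N)"
  have M: "M \<in> carrier_mat (Suc N) (Suc N)" by (simp add: M_def)
  have u: "u \<in> carrier_vec (Suc N)" by (simp add: u_def)
  have Mij: "M $$ (i, j) = (if i = j then [:0, 1:] else 0) - [:T i j:]" if "i \<le> N" "j \<le> N" for i j
    using that by (auto simp: M_def char_poly_matrix_def trunc_def)
  have "M *\<^sub>v u = Matrix.vec (Suc N) (\<lambda>n. if n = N then U (Suc N) (Suc N) else 0)"
  proof (rule eq_vecI)
    fix n assume "n < dim_vec (Matrix.vec (Suc N) (\<lambda>n. if n = N then U (Suc N) (Suc N) else 0))"
    then have n: "n \<le> N" by simp
    have "(M *\<^sub>v u) $ n = (\<Sum>l\<le>N. M $$ (n, l) * U N l)"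
      using n M by (simp add: u_def scalar_prod_def atLeast0LessThan lessThan_Suc_atMost)
    also have "\<dots> = (\<Sum>l\<le>N. (if n = l then [:0, 1:] * U N l else 0) - Polynomial.smult (T n l) (U N l))"
      by (rule sum.cong) (auto simp: Mij[OF n] left_diff_distrib)
    also have "\<dots> = [:0, 1:] * U N n - (\<Sum>l\<le>N. Polynomial.smult (T n l) (U N l))"
      using n by (simp add: sum_subtractf)
    finally show "(M *\<^sub>v u) $ n = Matrix.vec (Suc N) (\<lambda>n. if n = N then U (Suc N) (Suc N) else 0) $ n"
      using n U_recursion_aux[OF n] by simp
  qed (use M in simp)
  then have "(adj_mat M * M) *\<^sub>v u
      = adj_mat M *\<^sub>v Matrix.vec (Suc N) (\<lambda>n. if n = N then U (Suc N) (Suc N) else 0)"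
    using adj_mat(1)[OF M] M u by simp
  moreover have "((adj_mat M * M) *\<^sub>v u) $ N = charP T (Suc N) * U N N"
    unfolding adj_mat(3)[OF M]
    by (simp add: u_def scalar_prod_def if_distrib[of "\<lambda>x. _ * x"] if_distrib[of "\<lambda>x. x * _"] cong: if_cong)
       (simp add: M_def charP_def char_poly_def)
  moreover have "(adj_mat M *\<^sub>v Matrix.vec (Suc N) (\<lambda>n. if n = N then U (Suc N) (Suc N) else 0)) $ N
      = U (Suc N) (Suc N) * charP T N"
  proof -
    \<comment> \<open>Deleting the last row and column leaves the characteristic matrix of the
      previous truncation; for \<open>N = 0\<close> it is empty, with determinant 1.\<close>
    have "mat_delete M N N = (case N of 0 \<Rightarrow> 1\<^sub>m 0 | Suc K \<Rightarrow> char_poly_matrix (trunc T K))"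
      by (rule eq_matI) (auto simp: mat_delete_def M_def char_poly_matrix_def trunc_def split: nat.splits)
    then have "cofactor M N N = charP T N"
      by (simp add: cofactor_def charP_def char_poly_def split: nat.splits)
    then have "adj_mat M $$ (N, N) = charP T N" using M by (simp add: adj_mat_def)
    then show ?thesis using adj_mat(1)[OF M]
      by (simp add: scalar_prod_def mult.commute)
  qed
  ultimately show ?thesis by simp
qed

text \<open>Induction on \<open>N\<close>: \<open>charP_mult_U\<close> determines the next diagonal
  entry once the nonzero polynomial \<open>charP T N\<close> is cancelled.\<close>

lemma U_diagonal: "U N N = charP T N"
proof (induction N)
  case 0
  \<comment> \<open>By the initial conditions this matrix is the unitriangular \<xi>, with constant
    polynomials as entries.\<close>
  have "det (Matrix.mat q q (\<lambda>(i, j). B (Suc j) i)) = (\<Prod>i = 0..<q. B (Suc i) i)"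
    by (subst det_lower_triangular[of q])
       (use recursion xi in \<open>auto simp: right_recursion_polys_def lower_unitriangular_def prod_list_diag_prod\<close>)
  also have "\<dots> = 1"
    using recursion xi
    by (intro prod.neutral) (auto simp: right_recursion_polys_def lower_unitriangular_def)
  also have "Matrix.mat q q (\<lambda>(i, j). B (Suc j) i)
      = Matrix.mat q q (\<lambda>(i, j). B (Suc j) (if i = 0 then 0 else 0 + i))"
    by (rule cong_mat) auto
  finally show ?case by (simp add: U_def beta_def rec_det_def charP_def)
next
  case (Suc N)
  then show ?case using charP_mult_U[of N] charP_nonzero[of T N] by simp
qed

lemma U_recursion:
  assumes "n \<le> N"
  shows "[:0, 1:] * U N n
    = (\<Sum>l\<le>N. Polynomial.smult (T n l) (U N l)) + (if n = N then charP T (Suc N) else 0)"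
  using U_recursion_aux[OF assms] by (simp add: U_diagonal)

lemma poly_U_recursion:
  assumes "n \<le> N"
  shows "(\<Sum>l\<le>N. T n l * poly (U N l) x) = x * poly (U N n) x - (if n = N then poly (charP T (Suc N)) x else 0)"
  using arg_cong[OF U_recursion[OF assms], of "\<lambda>p. poly p x"] by (simp add: poly_sum)

end

section \<open>Interlacing of the eigenvalues\<close>

lemma monic_eq_prod_roots:
  fixes p :: "real poly"
  assumes "degree p = n" and "coeff p n = 1" and "inj_on r {..<n}"
    and "\<And>i. i < n \<Longrightarrow> poly p (r i) = 0"
  shows "p = (\<Prod>i<n. [:- r i, 1:])"
proof -
  define d where "d = (\<Prod>i<n. [:- r i, 1:])"
  have deg: "degree d = n" unfolding d_def by (subst degree_prod_sum_eq) auto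
  have "p = d"
  proof (rule poly_eqI_degree_lead_coeff[where A = "r ` {..<n}" and n = n])
    show "coeff p n = coeff d n"
      using lead_coeff_prod[of "\<lambda>i. [:- r i, 1:]" "{..<n}"] deg assms(2) by (simp add: d_def)
  qed (use assms deg in \<open>auto simp: card_image d_def poly_prod\<close>)
  then show ?thesis by (simp add: d_def)
qed

lemma prod_sign:
  fixes f :: "nat \<Rightarrow> real"
  assumes "i \<le> n" and "\<And>j. j < i \<Longrightarrow> 0 < f j" and "\<And>j. i \<le> j \<Longrightarrow> j < n \<Longrightarrow> f j < 0"
  shows "0 < (-1) ^ (n - i) * (\<Prod>j<n. f j)"
  using assms(1,3)
proof (induction n rule: dec_induct)
  case base
  then show ?case using assms(2) by (auto intro!: prod_pos)
next
  case (step n)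
  then have "0 < (-1) ^ (n - i) * (\<Prod>j<n. f j)" "0 < - f n" by auto
  then have "0 < (-1) ^ (n - i) * (\<Prod>j<n. f j) * (- f n)" by (rule mult_pos_pos)
  then show ?case using step by (simp add: Suc_diff_le)
qed

locale two_sided_recursion =
  R: right_recursion q T \<xi> B + L: right_recursion p "smat_transpose T" \<nu> A
  for p q :: nat and T :: smat and \<nu> \<xi> :: "real mat" and A B :: "nat \<Rightarrow> nat \<Rightarrow> real poly" +
  assumes LU: "pos_LU_product T"
    and nonneg: "\<And>n m. 0 \<le> T n m" and super_pos: "\<And>n. 0 < T n (Suc n)"
begin

abbreviation "P \<equiv> charP T"
abbreviation "U \<equiv> R.U"
abbreviation "W \<equiv> L.U"

lemma W_diagonal: "W N N = P N"
  by (simp add: L.U_diagonal charP_transpose)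

lemma W_recursion:
  assumes "n \<le> N"
  shows "(\<Sum>l\<le>N. T l n * poly (W N l) x) = x * poly (W N n) x - (if n = N then poly (P (Suc N)) x else 0)"
  using L.poly_U_recursion[OF assms] by (simp add: charP_transpose smat_transpose_apply)

lemma U_recursion_Suc:
  assumes "n \<le> Suc N"
  shows "(\<Sum>l\<le>N. T n l * poly (U (Suc N) l) x) = x * poly (U (Suc N) n) x
    - T n (Suc N) * poly (P (Suc N)) x - (if n = Suc N then poly (P (Suc (Suc N))) x else 0)"
  using R.poly_U_recursion[OF assms, of x] by (simp add: R.U_diagonal)

text \<open>Pairing the first rows of the recursion for \<open>U (Suc N)\<close> with
  \<open>W N\<close> and summing in both orders leaves only the two boundary terms, each with the
  factor \<open>P (Suc N)\<close>. The identity links right determinants at level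
  \<open>Suc N\<close> with left ones at level \<open>N\<close>.\<close>

lemma U_subdiagonal: "poly (U (Suc N) N) x = (\<Sum>l\<le>N. T l (Suc N) * poly (W N l) x)"
proof -
  define D where "D = U (Suc N) N - (\<Sum>l\<le>N. Polynomial.smult (T l (Suc N)) (W N l))"
  have "poly (P (Suc N) * D) x = 0" for x
  proof -
    let ?u = "\<lambda>l. poly (U (Suc N) l) x" and ?w = "\<lambda>l. poly (W N l) x" and ?P = "poly (P (Suc N)) x"
    have "(\<Sum>n\<le>N. ?w n * (\<Sum>l\<le>N. T n l * ?u l)) = (\<Sum>n\<le>N. \<Sum>l\<le>N. ?u l * (T n l * ?w n))"
      by (simp add: sum_distrib_left algebra_simps)
    also have "\<dots> = (\<Sum>l\<le>N. ?u l * (\<Sum>n\<le>N. T n l * ?w n))"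
      unfolding sum_distrib_left by (rule sum.swap)
    also have "\<dots> = (\<Sum>l\<le>N. x * ?u l * ?w l - (if l = N then ?u N * ?P else 0))"
      by (rule sum.cong) (auto simp: W_recursion algebra_simps)
    finally have "(\<Sum>n\<le>N. ?w n * (\<Sum>l\<le>N. T n l * ?u l)) = (\<Sum>l\<le>N. x * ?u l * ?w l) - ?u N * ?P"
      by (simp add: sum_subtractf)
    moreover have "(\<Sum>n\<le>N. ?w n * (\<Sum>l\<le>N. T n l * ?u l))
        = (\<Sum>n\<le>N. x * ?u n * ?w n - ?P * (T n (Suc N) * ?w n))"
      by (rule sum.cong) (auto simp: U_recursion_Suc algebra_simps)
    ultimately show ?thesis
      by (simp add: D_def poly_sum sum_subtractf sum_distrib_left algebra_simps)
  qed
  \<comment> \<open>The factor is cancelled between polynomials, because the identity is needed at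
    the roots of \<open>P (Suc N)\<close>, where pointwise division fails.\<close>
  then have "P (Suc N) * D = 0" using poly_all_0_iff_0 by blast
  then have "D = 0" using charP_nonzero by simp
  then show ?thesis using arg_cong[of D 0 "\<lambda>p. poly p x"] by (simp add: D_def poly_sum)
qed

text \<open>The sign lemma is applied twice. For the transpose and the left eigenvector, the new
  component is \<open>U (Suc N) N\<close>, which thus has the sign of \<open>P N\<close>. The
  entries \<open>U (Suc N) l\<close> with \<open>l \<le> N\<close> then form a right eigenvector,
  and its new component is the negative of \<open>P (Suc (Suc N))\<close>.\<close>

lemma sturm_sign:
  assumes mu: "0 < \<mu>" and root: "poly (P (Suc N)) \<mu> = 0" and ne: "poly (P N) \<mu> \<noteq> 0"
  shows "poly (P (Suc (Suc N))) \<mu> * poly (P N) \<mu> < 0"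
proof -
  have "0 < poly (W N N) \<mu> * (\<Sum>l\<le>N. smat_transpose T (Suc N) l * poly (W N l) \<mu>)"
    by (rule eigenvector_next_component_sign[OF pos_LU_product_transpose[OF LU] mu])
       (use ne root W_recursion in \<open>auto simp: W_diagonal smat_transpose_apply\<close>)
  then have 1: "0 < poly (P N) \<mu> * poly (U (Suc N) N) \<mu>"
    by (simp add: W_diagonal smat_transpose_apply U_subdiagonal)
  have "0 < poly (U (Suc N) N) \<mu> * (\<Sum>l\<le>N. T (Suc N) l * poly (U (Suc N) l) \<mu>)"
    by (rule eigenvector_next_component_sign[OF LU mu])
       (use 1 root in \<open>auto simp: U_recursion_Suc\<close>)
  then have "0 < poly (U (Suc N) N) \<mu> * (- poly (P (Suc (Suc N))) \<mu>)"
    using root by (simp add: U_recursion_Suc R.U_diagonal)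
  with 1 show ?thesis by (auto simp: zero_less_mult_iff mult_less_0_iff)
qed

text \<open>The roots are listed in increasing order, opposite to \<open>lam\<close>. Interlacing is
  expressed by the alternating signs of \<open>P N\<close> at the roots of \<open>P (Suc N)\<close>,
  the form in which \<open>sturm_sign\<close> uses and propagates it.\<close>

definition interlacing :: "nat \<Rightarrow> (nat \<Rightarrow> real) \<Rightarrow> bool" where
  "interlacing N r \<longleftrightarrow> 0 < r 0 \<and> (\<forall>i<N. r i < r (Suc i)) \<and>
     P (Suc N) = (\<Prod>i<Suc N. [:- r i, 1:]) \<and> (\<forall>i\<le>N. 0 < (-1) ^ (N - i) * poly (P N) (r i))"

lemma interlacing_less:
  assumes "interlacing N r" and "i < j" and "j \<le> N"
  shows "r i < r j"
  using assms(2,3)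
proof (induction j)
  case 0
  then show ?case by simp
next
  case (Suc j)
  have "r j < r (Suc j)" using assms(1) Suc.prems by (simp add: interlacing_def)
  then show ?case using Suc by (cases "i = j") auto
qed

lemma interlacing_pos:
  assumes "interlacing N r" and "i \<le> N"
  shows "0 < r i"
  using assms interlacing_less[OF assms(1), of 0 i] by (cases "i = 0") (auto simp: interlacing_def)

lemma interlacing_poly:
  assumes "interlacing N r"
  shows "poly (P (Suc N)) x = (\<Prod>i<Suc N. x - r i)"
proof -
  have "P (Suc N) = (\<Prod>i<Suc N. [:- r i, 1:])" using assms unfolding interlacing_def by blast
  then show ?thesis by (simp add: poly_prod del: prod.lessThan_Suc)
qed

lemma interlacing_root:
  assumes "interlacing N r"
  shows "poly (P (Suc N)) x = 0 \<longleftrightarrow> (\<exists>i\<le>N. x = r i)"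
  unfolding interlacing_poly[OF assms] by (auto simp: less_Suc_eq_le simp del: prod.lessThan_Suc)

lemma interlacing_sign:
  assumes "interlacing N r" and "i \<le> N"
  shows "0 < (-1) ^ (N - i) * poly (P N) (r i)"
  using assms unfolding interlacing_def by blast

text \<open>The next polynomial alternates in sign along 0, the old roots and a large number. The
  intermediate value theorem puts a root into each gap, and these are as many as its degree.\<close>

lemma interlacing_step:
  assumes r: "interlacing N r"
  obtains s where "interlacing (Suc N) s" and "r N < s (Suc N)"
proof -
  let ?P = "P (Suc (Suc N))"
  obtain z0 where z0: "\<forall>x\<ge>z0. 0 < poly ?P x" using charP_pos_at_top by blast
  define z where "z = max z0 (r N + 1)"
  \<comment> \<open>The nodes of the sign table; the old root \<open>r j\<close> is the node with
    index \<open>Suc j\<close>.\<close>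
  define t where "t i = (if i = 0 then 0 else if i = Suc (Suc N) then z else r (i - 1))" for i
  have t_step: "t i < t (Suc i)" if "i \<le> Suc N" for i
    using that interlacing_less[OF r, of "i - 1" i] interlacing_pos[OF r, of 0]
    by (auto simp: t_def z_def)
  have t_sign: "0 < (-1) ^ (Suc (Suc N) - i) * poly ?P (t i)" if i: "i \<le> Suc (Suc N)" for i
  proof -
    consider "i = 0" | "i = Suc (Suc N)" | j where "i = Suc j" "j \<le> N"
      using i by (cases i) force+
    then show ?thesis
    proof cases
      case 1
      then show ?thesis using charP_at_0[OF LU, of "Suc (Suc N)"] by (simp add: t_def)
    next
      case 2
      then show ?thesis using z0 by (simp add: t_def z_def)
    next
      case 3
      have *: "0 < (-1) ^ (N - j) * poly (P N) (r j)" using interlacing_sign[OF r] 3 by simp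
      then have "poly ?P (r j) * poly (P N) (r j) < 0"
        by (intro sturm_sign interlacing_pos[OF r]) (use 3 interlacing_root[OF r] in auto)
      with * have "(-1) ^ (N - j) * poly ?P (r j) < 0"
        by (cases "even (N - j)") (auto simp: mult_less_0_iff)
      then show ?thesis using 3 by (simp add: t_def Suc_diff_le)
    qed
  qed
  have "\<exists>s. t i < s \<and> s < t (Suc i) \<and> poly ?P s = 0" if "i \<le> Suc N" for i
  proof -
    have "0 < ((-1) ^ (Suc (Suc N) - i) * poly ?P (t i)) * ((-1) ^ (Suc (Suc N) - Suc i) * poly ?P (t (Suc i)))"
      by (intro mult_pos_pos t_sign) (use that in auto)
    moreover have "(-1) ^ (Suc (Suc N) - i) = - ((-1) ^ (Suc (Suc N) - Suc i) :: real)"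
      using that by (simp add: Suc_diff_le)
    ultimately have "poly ?P (t i) * poly ?P (t (Suc i)) < 0"
      by (cases "even (Suc (Suc N) - Suc i)") (auto simp: mult_less_0_iff zero_less_mult_iff)
    then show ?thesis using poly_IVT[OF t_step[OF that]] by blast
  qed
  then obtain s where s: "\<And>i. i \<le> Suc N \<Longrightarrow> t i < s i \<and> s i < t (Suc i) \<and> poly ?P (s i) = 0"
    by metis
  have s_step: "s i < s (Suc i)" if "i < Suc N" for i
    using s[of i] s[of "Suc i"] that by auto
  have mono: "s i < s j" if "i < j" "j \<le> Suc N" for i j
    using that
  proof (induction j)
    case (Suc j)
    then show ?case using s_step[of j] by (cases "i = j") auto
  qed simp
  have "inj_on s {..<Suc (Suc N)}"
    by (rule linorder_inj_onI) (use mono in \<open>force simp: less_Suc_eq_le\<close>)+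
  then have prod: "?P = (\<Prod>i<Suc (Suc N). [:- s i, 1:])"
    by (intro monic_eq_prod_roots) (use charP_degree s in auto)
  have t_mono: "t i \<le> t j" if "i \<le> j" "j \<le> Suc (Suc N)" for i j
    using that
  proof (induction j rule: dec_induct)
    case (step j)
    then show ?case using t_step[of j] by auto
  qed simp
  have sign: "0 < (-1) ^ (Suc N - i) * poly (P (Suc N)) (s i)" if i: "i \<le> Suc N" for i
  proof -
    \<comment> \<open>The root \<open>s i\<close> lies above exactly the old roots
      \<open>r j\<close> with \<open>j < i\<close>, so \<open>Suc N - i\<close> factors are
      negative.\<close>
    have "0 < (-1) ^ (Suc N - i) * (\<Prod>j<Suc N. s i - r j)"
    proof (rule prod_sign[OF i])
      show "0 < s i - r j" if "j < i" for j
        using s[OF i] t_mono[of "Suc j" i] that i by (auto simp: t_def)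
      show "s i - r j < 0" if "i \<le> j" "j < Suc N" for j
        using s[OF i] t_mono[of "Suc i" "Suc j"] that i by (auto simp: t_def)
    qed
    then show ?thesis by (simp add: interlacing_poly[OF r])
  qed
  show thesis
  proof (rule that)
    show "interlacing (Suc N) s"
      unfolding interlacing_def using s[of 0] s_step prod sign by (auto simp: t_def)
    show "r N < s (Suc N)" using s[of "Suc N"] by (simp add: t_def)
  qed
qed

lemma interlacing_base: "interlacing 0 (\<lambda>_. T 0 0)"
proof -
  have "[:0, 1:] = [:T 0 0:] + P 1"
    using R.U_recursion[of 0 0] by (simp add: R.U_diagonal charP_def[of T 0])
  then have "P 1 = [:0, 1:] - [:T 0 0:]" by (simp only: add_diff_cancel_left')
  then have "[:- T 0 0, 1:] = P 1" by simp
  moreover have "0 < T 0 0" using charP_at_0[OF LU, of 1] calculation[symmetric] by simp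
  ultimately show ?thesis by (simp add: interlacing_def charP_def[of T 0])
qed

section \<open>Positivity of the leading eigenvector\<close>

text \<open>Compare \<open>v\<close> with the multiple of the positive eigenvector \<open>u\<close> that touches it from below.\<close>

lemma nonneg_of_supersolution:
  assumes u: "\<And>n. n \<le> N \<Longrightarrow> 0 < u n" and eig: "\<And>n. n \<le> N \<Longrightarrow> (\<Sum>l\<le>N. T n l * u l) = \<rho> * u n"
    and "\<rho> < \<mu>" and v: "\<And>n. n \<le> N \<Longrightarrow> (\<Sum>l\<le>N. T n l * v l) \<le> \<mu> * v n" and n: "n \<le> N"
  shows "0 \<le> v n"
proof -
  obtain i where i: "i \<le> N" and min: "\<And>l. l \<le> N \<Longrightarrow> v i / u i \<le> v l / u l"
    using ex_min_if_finite[of "(\<lambda>l. v l / u l) ` {..N}"] by (fastforce simp: not_less)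
  define \<kappa> where "\<kappa> = v i / u i"
  have vi: "v i = \<kappa> * u i" using u[OF i] by (simp add: \<kappa>_def)
  have le: "\<kappa> * u l \<le> v l" if "l \<le> N" for l
    using min[OF that] u[OF that] by (simp add: \<kappa>_def[symmetric] pos_le_divide_eq)
  \<comment> \<open>At the touching index, nonnegativity of \<open>T\<close> turns
    \<kappa>\<open>u\<close> \<le> \<open>v\<close> into \<kappa>\<rho> \<le> \<mu>\<kappa>, and
    \<rho> < \<mu> forces \<kappa> \<ge> 0.\<close>
  have "\<kappa> * \<rho> * u i = (\<Sum>l\<le>N. T i l * (\<kappa> * u l))"
    using eig[OF i] by (simp add: sum_distrib_left[symmetric] mult.left_commute[of _ \<kappa>])
  also have "\<dots> \<le> (\<Sum>l\<le>N. T i l * v l)"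
    by (intro sum_mono mult_left_mono) (use le nonneg in auto)
  also have "\<dots> \<le> \<mu> * \<kappa> * u i" using v[OF i] by (simp add: vi)
  finally have "\<kappa> * \<rho> \<le> \<mu> * \<kappa>" by (rule mult_right_le_imp_le) (use u[OF i] in simp)
  then have "0 \<le> (\<mu> - \<rho>) * \<kappa>" by (simp add: algebra_simps)
  then have "0 \<le> \<kappa>" using \<open>\<rho> < \<mu>\<close> by (simp add: zero_le_mult_iff)
  then show ?thesis using le[OF n] u[OF n] by (meson less_imp_le mult_nonneg_nonneg order_trans)
qed

text \<open>Positivity of the top eigenvector is carried through the induction. The new one, with
  its positive last entry removed, is a supersolution for the old truncation at the larger value
  \<mu>, and is compared with the old positive eigenvector.\<close>

lemma spectrum:
  "\<exists>r. interlacing N r \<and> (\<forall>n\<le>N. 0 < poly (U N n) (r N))"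
proof (induction N)
  case 0
  show ?case
    by (rule exI[of _ "\<lambda>_. T 0 0"]) (use interlacing_base R.U_diagonal[of 0] in \<open>simp add: charP_def\<close>)
next
  case (Suc N)
  then obtain r where r: "interlacing N r" and pos: "\<And>n. n \<le> N \<Longrightarrow> 0 < poly (U N n) (r N)" by blast
  obtain s where s: "interlacing (Suc N) s" and less: "r N < s (Suc N)"
    using interlacing_step[OF r] .
  define \<mu> where "\<mu> = s (Suc N)"
  define v where "v n = poly (U (Suc N) n) \<mu>" for n
  have mu: "0 < \<mu>" using interlacing_pos[OF s] by (simp add: \<mu>_def)
  have root: "poly (P (Suc (Suc N))) \<mu> = 0" using interlacing_root[OF s] by (auto simp: \<mu>_def)
  have last: "0 < v (Suc N)" using interlacing_sign[OF s, of "Suc N"] by (simp add: v_def R.U_diagonal \<mu>_def)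
  have eig: "(\<Sum>l\<le>Suc N. T n l * v l) = \<mu> * v n" if "n \<le> Suc N" for n
    using R.poly_U_recursion[OF that, of \<mu>] root by (simp add: v_def)
  have v0: "0 \<le> v n" if "n \<le> N" for n
  proof (rule nonneg_of_supersolution[OF pos _ _ _ that])
    show "(\<Sum>l\<le>N. T n l * poly (U N l) (r N)) = r N * poly (U N n) (r N)" if "n \<le> N" for n
      using R.poly_U_recursion[OF that, of "r N"] interlacing_root[OF r] by auto
    show "r N < \<mu>" using less by (simp add: \<mu>_def)
    show "(\<Sum>l\<le>N. T n l * v l) \<le> \<mu> * v n" if "n \<le> N" for n
      using eig[of n] that mult_nonneg_nonneg[OF nonneg[of n "Suc N"] less_imp_le[OF last]]
      by simp
  qed
  \<comment> \<open>Strictness descends from the last entry: the superdiagonal entry of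
    \<open>T\<close> carries positivity from \<open>Suc n\<close> to \<open>n\<close>.\<close>
  have "0 < v n" if "n \<le> Suc N" for n
    using that
  proof (induction n rule: inc_induct)
    case base
    then show ?case by (rule last)
  next
    case (step n)
    have "0 < T n (Suc n) * v (Suc n)" using step super_pos by simp
    also have "\<dots> \<le> (\<Sum>l\<le>Suc N. T n l * v l)"
      by (rule member_le_sum)
         (use step v0 last nonneg in \<open>auto simp: le_Suc_eq less_imp_le intro!: mult_nonneg_nonneg\<close>)
    finally show ?case using eig[of n] step mu by (simp add: zero_less_mult_iff)
  qed
  then show ?case using s by (auto simp: v_def \<mu>_def)
qed

end

section \<open>Biorthogonality\<close>

lemma mat_inv_mult:
  fixes M :: "real mat"
  assumes M: "M \<in> carrier_mat d d" and "det M \<noteq> 0"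
  shows "mat_inv M \<in> carrier_mat d d" and "mat_inv M * M = 1\<^sub>m d"
proof -
  have "M \<in> Units (ring_mat TYPE(real) d undefined)"
    using assms by (rule det_non_zero_imp_unit)
  then obtain B where "mat_inverse M = Some B"
    using mat_inverse(1)[OF M, of undefined] by (cases "mat_inverse M") auto
  then show "mat_inv M \<in> carrier_mat d d" and "mat_inv M * M = 1\<^sub>m d"
    using mat_inverse(2)[OF M] by (auto simp: mat_inv_def)
qed

text \<open>The vector is a combination of the \<open>B b\<close> with coefficients \<open>g\<close>
  independent of \<open>n\<close>. Its first \<open>q\<close> entries are \<xi> applied to
  \<open>g\<close>, so inverting \<xi> recovers the coefficients. The scalar \<kappa> allows for the
  denominator of \<open>wvec\<close>.\<close>

lemma (in right_recursion) christoffel_expansion: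
  fixes \<kappa> x :: real and N :: nat
  defines "y \<equiv> \<lambda>n. \<kappa> * poly (U N n) x"
  shows "y n = (\<Sum>b=1..q. poly (B b n) x * vec_index (mat_inv \<xi> *\<^sub>v Matrix.vec q y) (b - 1))"
proof -
  obtain c where c: "\<And>n. U N n = (\<Sum>b=1..q. c b * B b n)" using U_expansion[of N] by blast
  define g where "g b = \<kappa> * poly (c b) x" for b
  have y: "y n = (\<Sum>b=1..q. poly (B b n) x * g b)" for n
    by (simp add: y_def c poly_sum g_def sum_distrib_left mult_ac)
  have xi': "\<xi> \<in> carrier_mat q q" using xi by (simp add: lower_unitriangular_def)
  have "Matrix.vec q y = \<xi> *\<^sub>v Matrix.vec q (\<lambda>j. g (Suc j))"
  proof (rule eq_vecI)
    fix i assume "i < dim_vec (\<xi> *\<^sub>v Matrix.vec q (\<lambda>j. g (Suc j)))"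
    then have i: "i < q" using xi' by simp
    have "y i = (\<Sum>b=1..q. \<xi> $$ (i, b - 1) * g b)"
      unfolding y using recursion i by (intro sum.cong) (auto simp: right_recursion_polys_def)
    also have "\<dots> = (\<Sum>j<q. \<xi> $$ (i, j) * g (Suc j))"
      using sum.shift_bounds_cl_Suc_ivl[of "\<lambda>b. \<xi> $$ (i, b - 1) * g b" 0 "q - 1"] q
      by (simp add: lessThan_Suc_atMost[symmetric] atLeast0AtMost)
    finally show "Matrix.vec q y $ i = (\<xi> *\<^sub>v Matrix.vec q (\<lambda>j. g (Suc j))) $ i"
      using i xi' by (simp add: scalar_prod_def atLeast0LessThan)
  qed (use xi' in simp)
  then have "mat_inv \<xi> *\<^sub>v Matrix.vec q y = (mat_inv \<xi> * \<xi>) *\<^sub>v Matrix.vec q (\<lambda>j. g (Suc j))"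
    using mat_inv_mult(1)[OF xi'] lower_unitriangular_det[OF xi] xi'
    by (simp add: assoc_mult_mat_vec[of _ q q _ q])
  also have "\<dots> = Matrix.vec q (\<lambda>j. g (Suc j))"
    using mat_inv_mult(2)[OF xi'] lower_unitriangular_det[OF xi] by simp
  finally show ?thesis unfolding y by (intro sum.cong) auto
qed

context two_sided_recursion
begin

lemma bilinear_swap:
  fixes f g :: "nat \<Rightarrow> real"
  shows "(\<Sum>n\<le>N. g n * (\<Sum>l\<le>N. T n l * f l)) = (\<Sum>l\<le>N. f l * (\<Sum>n\<le>N. T n l * g n))"
proof -
  have "(\<Sum>n\<le>N. g n * (\<Sum>l\<le>N. T n l * f l)) = (\<Sum>n\<le>N. \<Sum>l\<le>N. f l * (T n l * g n))"
    by (simp add: sum_distrib_left mult_ac)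
  also have "\<dots> = (\<Sum>l\<le>N. f l * (\<Sum>n\<le>N. T n l * g n))"
    unfolding sum_distrib_left by (rule sum.swap)
  finally show ?thesis .
qed

lemma U_eigenvector:
  assumes "poly (P (Suc N)) x = 0" and "n \<le> N"
  shows "(\<Sum>l\<le>N. T n l * poly (U N l) x) = x * poly (U N n) x"
  using R.poly_U_recursion[OF assms(2), of x] assms(1) by simp

lemma W_eigenvector:
  assumes "poly (P (Suc N)) x = 0" and "n \<le> N"
  shows "(\<Sum>l\<le>N. T l n * poly (W N l) x) = x * poly (W N n) x"
  using W_recursion[OF assms(2), of x] assms(1) by simp

lemma orthogonal:
  assumes "poly (P (Suc N)) x = 0" and "poly (P (Suc N)) y = 0" and "x \<noteq> y"
  shows "(\<Sum>n\<le>N. poly (W N n) y * poly (U N n) x) = 0"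
proof -
  have "x * (\<Sum>n\<le>N. poly (W N n) y * poly (U N n) x)
      = (\<Sum>n\<le>N. poly (W N n) y * (\<Sum>l\<le>N. T n l * poly (U N l) x))"
    by (simp add: U_eigenvector[OF assms(1)] sum_distrib_left mult_ac)
  also have "\<dots> = (\<Sum>l\<le>N. poly (U N l) x * (\<Sum>n\<le>N. T n l * poly (W N n) y))"
    by (rule bilinear_swap)
  also have "\<dots> = y * (\<Sum>n\<le>N. poly (W N n) y * poly (U N n) x)"
    by (simp add: W_eigenvector[OF assms(2)] sum_distrib_left mult_ac)
  finally show ?thesis using assms(3) by simp
qed

text \<open>Differentiate the recursion of \<open>U\<close> with respect to \<open>x\<close> and pair it with the left eigenvector.\<close>

lemma normalization:
  assumes "poly (P (Suc N)) x = 0"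
  shows "(\<Sum>n\<le>N. poly (W N n) x * poly (U N n) x) = poly (P N) x * poly (pderiv (P (Suc N))) x"
proof -
  let ?w = "\<lambda>n. poly (W N n) x" and ?u = "\<lambda>n. poly (U N n) x"
  let ?d = "\<lambda>n. poly (pderiv (U N n)) x" and ?D = "poly (pderiv (P (Suc N))) x"
  have "?u n + x * ?d n = (\<Sum>l\<le>N. T n l * ?d l) + (if n = N then ?D else 0)" if "n \<le> N" for n
  proof -
    have "pderiv ([:0, 1:] * U N n)
        = pderiv ((\<Sum>l\<le>N. Polynomial.smult (T n l) (U N l)) + (if n = N then P (Suc N) else 0))"
      by (simp only: R.U_recursion[OF that])
    then have "poly (pderiv ([:0, 1:] * U N n)) x
        = poly (pderiv ((\<Sum>l\<le>N. Polynomial.smult (T n l) (U N l)) + (if n = N then P (Suc N) else 0))) x"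
      by simp
    moreover have "pderiv (\<Sum>l\<le>N. Polynomial.smult (T n l) (U N l))
        = (\<Sum>l\<le>N. Polynomial.smult (T n l) (pderiv (U N l)))"
      using higher_pderiv_sum[of 1 "\<lambda>l. Polynomial.smult (T n l) (U N l)" "{..N}"]
      by (simp add: pderiv_smult)
    ultimately show ?thesis by (auto simp: pderiv_mult pderiv_add pderiv_pCons poly_sum)
  qed
  then have "(\<Sum>n\<le>N. ?w n * (?u n + x * ?d n))
      = (\<Sum>n\<le>N. ?w n * (\<Sum>l\<le>N. T n l * ?d l) + (if n = N then ?w N * ?D else 0))"
    by (intro sum.cong) (auto simp: distrib_left)
  \<comment> \<open>After the sums are swapped, the left eigenvector relation makes the derivative
    terms of both sides cancel, leaving the boundary term.\<close>
  also have "\<dots> = (\<Sum>l\<le>N. ?d l * (\<Sum>n\<le>N. T n l * ?w n)) + ?w N * ?D"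
    by (simp add: sum.distrib bilinear_swap)
  also have "\<dots> = (\<Sum>n\<le>N. ?w n * (x * ?d n)) + poly (P N) x * ?D"
    by (simp add: W_eigenvector[OF assms] W_diagonal mult_ac)
  finally show ?thesis by (simp add: distrib_left sum.distrib)
qed

section \<open>Eigenvalues in decreasing order\<close>

lemma lam_eq:
  assumes r: "interlacing N r" and k: "k \<le> N"
  shows "lam T N k = r (N - k)"
proof -
  have "{x. eigenvalue (trunc T N) x} = r ` {..N}"
    using interlacing_root[OF r] by (auto simp: eigenvalue_root_char_poly[OF trunc_carrier] charP_def)
  moreover have "sorted_list_of_set (r ` {..N}) = map r [0..<Suc N]"
  proof (rule sorted_distinct_set_unique)
    have "sorted_wrt (<) (map r [0..<Suc N])"
      unfolding sorted_wrt_map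
      by (rule sorted_wrt_mono_rel[OF _ sorted_wrt_upt]) (use interlacing_less[OF r] in auto)
    then show "sorted (map r [0..<Suc N])" "distinct (map r [0..<Suc N])"
      unfolding strict_sorted_iff by auto
  qed (auto simp: atLeast0LessThan lessThan_Suc_atMost simp del: upt_Suc)
  ultimately have "lam T N k = rev (map r [0..<Suc N]) ! k" by (simp add: lam_def)
  also have "\<dots> = r (N - k)" using k by (subst rev_nth) (auto simp del: upt_Suc)
  finally show ?thesis .
qed

lemma lam_props:
  shows lam_inj: "inj_on (lam T N) {..N}"
    and lam_root: "k \<le> N \<Longrightarrow> poly (P (Suc N)) (lam T N k) = 0"
    and lam_charP: "k \<le> N \<Longrightarrow> poly (P N) (lam T N k) \<noteq> 0"
    and lam_pderiv: "k \<le> N \<Longrightarrow> poly (pderiv (P (Suc N))) (lam T N k) \<noteq> 0"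
    and lam_0_pos: "0 < lam T N 0"
    and U_lam_0_pos: "n \<le> N \<Longrightarrow> 0 < poly (U N n) (lam T N 0)"
proof -
  obtain r where r: "interlacing N r" and pos: "\<And>n. n \<le> N \<Longrightarrow> 0 < poly (U N n) (r N)"
    using spectrum by blast
  have inj: "i = j" if "r i = r j" "i \<le> N" "j \<le> N" for i j
    using that interlacing_less[OF r, of i j] interlacing_less[OF r, of j i] by (cases i j rule: linorder_cases) auto
  show "inj_on (lam T N) {..N}"
    by (rule inj_onI) (use inj in \<open>fastforce simp: lam_eq[OF r]\<close>)
  show "poly (P (Suc N)) (lam T N k) = 0" if "k \<le> N"
    using that interlacing_root[OF r] by (auto simp: lam_eq[OF r] intro!: exI[of _ "N - k"])
  show "poly (P N) (lam T N k) \<noteq> 0" if "k \<le> N"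
    using interlacing_sign[OF r, of "N - k"] that by (auto simp: lam_eq[OF r])
  show "poly (pderiv (P (Suc N))) (lam T N k) \<noteq> 0" if "k \<le> N"
  proof -
    define i where "i = N - k"
    \<comment> \<open>Splitting off the simple factor of \<open>r i\<close> reduces the derivative
      at \<open>r i\<close> to the product of the other factors, which are nonzero there.\<close>
    define Q where "Q = (\<Prod>j\<in>{..<Suc N} - {i}. [:- r j, 1:])"
    have "P (Suc N) = (\<Prod>j<Suc N. [:- r j, 1:])" using r unfolding interlacing_def by blast
    also have "\<dots> = [:- r i, 1:] * Q"
      unfolding Q_def by (rule prod.remove) (auto simp: i_def)
    finally have "poly (pderiv (P (Suc N))) (r i) = poly Q (r i)"
      by (simp only: pderiv_mult) (simp add: pderiv_pCons)
    also have "\<dots> \<noteq> 0" using inj[of i] by (auto simp: Q_def poly_prod i_def)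
    finally show ?thesis using that by (simp add: lam_eq[OF r] i_def)
  qed
  show "0 < lam T N 0" using interlacing_pos[OF r] by (simp add: lam_eq[OF r])
  show "0 < poly (U N n) (lam T N 0)" if "n \<le> N" using pos[OF that] by (simp add: lam_eq[OF r])
qed

section \<open>Spectral decomposition of the truncation\<close>

lemma uvec_eq: "uvec q T B N k n = poly (U N n) (lam T N k)"
  by (simp add: uvec_def R.U_def)

text \<open>Transposing \<open>T\<close> turns \<open>beta\<close> into \<open>alpha\<close>, so the
  transposed instance gives the numerator directly.\<close>

lemma wvec_eq: "wvec p T A N k n = poly (W N n) (lam T N k) /
    (poly (P N) (lam T N k) * poly (pderiv (P (Suc N))) (lam T N k))"
  by (simp add: wvec_def L.U_def alpha_def beta_def smat_transpose_apply)

lemma biorthogonal: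
  assumes "j \<le> N" and "k \<le> N"
  shows "(\<Sum>n\<le>N. wvec p T A N j n * uvec q T B N k n) = (if j = k then 1 else 0)"
proof -
  let ?c = "poly (P N) (lam T N j) * poly (pderiv (P (Suc N))) (lam T N j)"
  have "(\<Sum>n\<le>N. wvec p T A N j n * uvec q T B N k n)
      = (\<Sum>n\<le>N. poly (W N n) (lam T N j) * poly (U N n) (lam T N k)) / ?c"
    by (simp add: uvec_eq wvec_eq sum_divide_distrib)
  also have "\<dots> = (if j = k then 1 else 0)"
  proof (cases "j = k")
    case True
    then show ?thesis using assms lam_charP lam_pderiv by (simp add: normalization lam_root)
  next
    case False
    then have "lam T N k \<noteq> lam T N j" using lam_inj[of N] assms by (auto dest: inj_onD)
    then show ?thesis using False assms by (simp add: orthogonal lam_root)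
  qed
  finally show ?thesis .
qed

text \<open>Biorthogonality says that the matrix of left eigenvectors is a left inverse of the
  matrix of right ones; both are square, so it is a right inverse too.\<close>

lemma resolution_of_identity:
  assumes "n \<le> N" and "m \<le> N"
  shows "(\<Sum>j\<le>N. uvec q T B N j n * wvec p T A N j m) = (if n = m then 1 else 0)"
proof -
  define X where "X = Matrix.mat (Suc N) (Suc N) (\<lambda>(n, j). uvec q T B N j n)"
  define Y where "Y = Matrix.mat (Suc N) (Suc N) (\<lambda>(j, m). wvec p T A N j m)"
  have "Y * X = 1\<^sub>m (Suc N)"
    by (rule eq_matI)
       (auto simp: X_def Y_def scalar_prod_def atLeast0LessThan lessThan_Suc_atMost biorthogonal
          simp del: sum.lessThan_Suc)
  then have "X * Y = 1\<^sub>m (Suc N)"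
    by (rule mat_mult_left_right_inverse[rotated 2]) (auto simp: X_def Y_def)
  moreover have "(X * Y) $$ (n, m) = (\<Sum>j\<le>N. uvec q T B N j n * wvec p T A N j m)"
    using assms by (simp add: X_def Y_def scalar_prod_def atLeast0LessThan lessThan_Suc_atMost
        del: sum.lessThan_Suc)
  ultimately show ?thesis using assms by simp
qed

lemma wvec_left_eigenvector:
  assumes "j \<le> N" and "m \<le> N"
  shows "(\<Sum>l\<le>N. wvec p T A N j l * T l m) = lam T N j * wvec p T A N j m"
  using W_recursion[OF assms(2), of "lam T N j"] lam_root[OF assms(1)]
  by (simp add: wvec_eq sum_divide_distrib[symmetric] mult.commute)

lemma trunc_power_Suc:
  assumes "n \<le> N" and "m \<le> N"
  shows "(trunc T N ^\<^sub>m Suc k) $$ (n, m) = (\<Sum>l\<le>N. (trunc T N ^\<^sub>m k) $$ (n, l) * T l m)"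
  using assms
  by (simp add: scalar_prod_def atLeast0LessThan lessThan_Suc_atMost carrier_matD[OF trunc_carrier]
      trunc_index del: sum.lessThan_Suc)

text \<open>The case \<open>k = 0\<close> is the resolution of the identity, and each further factor
  on the right multiplies the left eigenvectors by their eigenvalues.\<close>

lemma trunc_power:
  assumes "n \<le> N" and "m \<le> N"
  shows "(trunc T N ^\<^sub>m k) $$ (n, m)
    = (\<Sum>j\<le>N. uvec q T B N j n * lam T N j ^ k * wvec p T A N j m)"
  using assms(2)
proof (induction k arbitrary: m)
  case 0
  then show ?case using assms resolution_of_identity by (simp add: trunc_def)
next
  case (Suc k)
  have "(trunc T N ^\<^sub>m Suc k) $$ (n, m) = (\<Sum>l\<le>N. (trunc T N ^\<^sub>m k) $$ (n, l) * T l m)"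
    by (rule trunc_power_Suc[OF assms(1) Suc.prems])
  also have "\<dots> = (\<Sum>l\<le>N. \<Sum>j\<le>N. uvec q T B N j n * lam T N j ^ k * (wvec p T A N j l * T l m))"
    using Suc.IH by (simp add: sum_distrib_right mult.assoc)
  also have "\<dots> = (\<Sum>j\<le>N. uvec q T B N j n * lam T N j ^ k * (\<Sum>l\<le>N. wvec p T A N j l * T l m))"
    unfolding sum_distrib_left by (rule sum.swap)
  also have "\<dots> = (\<Sum>j\<le>N. uvec q T B N j n * lam T N j ^ k * (lam T N j * wvec p T A N j m))"
    using Suc.prems by (simp add: wvec_left_eigenvector)
  finally show ?case by (simp add: mult_ac)
qed

lemma That_power:
  assumes "n \<le> N" and "m \<le> N"
  shows "(That q T B N ^\<^sub>m k) $$ (n, m) = uvec q T B N 0 m / uvec q T B N 0 n *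
    (\<Sum>j\<le>N. uvec q T B N j n * (lam T N j / lam T N 0) ^ k * wvec p T A N j m)"
proof -
  define u where "u = uvec q T B N 0"
  define D where "D = mat_diag (Suc N) u"
  define D' where "D' = mat_diag (Suc N) (\<lambda>i. 1 / u i)"
  have D: "D \<in> carrier_mat (Suc N) (Suc N)" and D': "D' \<in> carrier_mat (Suc N) (Suc N)"
    by (simp_all add: D_def D'_def)
  have upos: "0 < u i" if "i \<le> N" for i using U_lam_0_pos[OF that] by (simp add: u_def uvec_eq)
  then have u0: "u i \<noteq> 0" if "i \<le> N" for i using that by (simp add: less_imp_neq[symmetric])
  have DD': "D * D' = 1\<^sub>m (Suc N)" "D' * D = 1\<^sub>m (Suc N)"
    unfolding D_def D'_def mat_diag_diag
    by (auto simp: mat_diag_def less_Suc_eq_le u0 intro!: eq_matI)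
  \<comment> \<open>\<open>mat_inv\<close> is specified for invertible matrices, so invertibility
    comes first; uniqueness of inverses then identifies it with the explicit
    \<open>D'\<close>.\<close>
  have "det D \<noteq> 0" using det_mult[OF D D'] DD' by auto
  then have "mat_inv D \<in> carrier_mat (Suc N) (Suc N)" "mat_inv D * D = 1\<^sub>m (Suc N)"
    using mat_inv_mult[OF D] by auto
  then have inv: "mat_inv D = D'"
    using assoc_mult_mat[of "mat_inv D" "Suc N" "Suc N" D "Suc N" D' "Suc N"] D D' DD' by simp
  have entry: "(D' * X * D) $$ (i, j) = u j / u i * X $$ (i, j)"
    if "X \<in> carrier_mat (Suc N) (Suc N)" "i \<le> N" "j \<le> N" for X :: "real mat" and i j
    using that unfolding D_def D'_def
    by (simp add: mat_diag_mult_left[of _ "Suc N" "Suc N"] mat_diag_mult_right[of _ "Suc N" "Suc N"])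
  have That: "That q T B N = (1 / lam T N 0) \<cdot>\<^sub>m (D' * trunc T N * D)"
    by (simp add: That_def Let_def inv u_def[symmetric] D_def[symmetric])
  then have carrier: "That q T B N \<in> carrier_mat (Suc N) (Suc N)"
    using carrier_matD[OF D] carrier_matD[OF D'] by (intro carrier_matI) simp_all
  have That_entry: "That q T B N $$ (i, j) = u j / u i * T i j / lam T N 0" if "i \<le> N" "j \<le> N" for i j
    unfolding That using that carrier_matD[OF D] carrier_matD[OF D']
    by (subst index_smult_mat) (simp_all add: entry trunc_index del: index_mult_mat(1))
  have "(That q T B N ^\<^sub>m k) $$ (n, m)
      = (1 / lam T N 0) ^ k * (u m / u n * (trunc T N ^\<^sub>m k) $$ (n, m))"
    using assms(2)
  proof (induction k arbitrary: m)
    case 0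
    then show ?case
      using assms(1) upos[of n] by (auto simp: carrier_matD[OF carrier] carrier_matD[OF trunc_carrier])
  next
    case (Suc k)
    have "(That q T B N ^\<^sub>m Suc k) $$ (n, m)
        = (\<Sum>l\<le>N. (That q T B N ^\<^sub>m k) $$ (n, l) * That q T B N $$ (l, m))"
      using assms(1) Suc.prems carrier
      by (simp add: scalar_prod_def atLeast0LessThan lessThan_Suc_atMost carrier_matD[OF carrier]
          del: sum.lessThan_Suc)
    also have "\<dots> = (\<Sum>l\<le>N. (1 / lam T N 0) ^ Suc k * (u m / u n) * ((trunc T N ^\<^sub>m k) $$ (n, l) * T l m))"
    proof (rule sum.cong[OF refl])
      fix l assume "l \<in> {..N}"
      then have l: "l \<le> N" by simp
      show "(That q T B N ^\<^sub>m k) $$ (n, l) * That q T B N $$ (l, m)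
          = (1 / lam T N 0) ^ Suc k * (u m / u n) * ((trunc T N ^\<^sub>m k) $$ (n, l) * T l m)"
        \<comment> \<open>The weight \<open>u l\<close> cancels between the two consecutive
          conjugated factors.\<close>
        using Suc.IH[OF l] That_entry[OF l Suc.prems] u0[OF l] by (simp add: field_simps)
    qed
    also have "\<dots> = (1 / lam T N 0) ^ Suc k * (u m / u n) * (trunc T N ^\<^sub>m Suc k) $$ (n, m)"
      by (simp only: sum_distrib_left[symmetric] trunc_power_Suc[OF assms(1) Suc.prems])
    finally show ?case by (simp add: mult.assoc)
  qed
  also have "\<dots> = u m / u n *
    (\<Sum>j\<le>N. uvec q T B N j n * (lam T N j / lam T N 0) ^ k * wvec p T A N j m)"
    unfolding trunc_power[OF assms] by (simp add: sum_distrib_left power_divide mult_ac)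
  finally show ?thesis by (simp add: u_def)
qed

section \<open>Christoffel numbers and discrete measures\<close>

lemma uvec_christoffel:
  "uvec q T B N k n = (\<Sum>b=1..q. poly (B b n) (lam T N k) * christoffel_rho q T \<xi> B N k b)"
  using R.christoffel_expansion[where \<kappa> = 1 and N = N and x = "lam T N k" and n = n]
  by (simp add: christoffel_rho_def uvec_eq)

lemma wvec_christoffel:
  "wvec p T A N k n = (\<Sum>a=1..p. poly (A a n) (lam T N k) * christoffel_mu p T \<nu> A N k a)"
  using L.christoffel_expansion[where N = N and x = "lam T N k" and n = n and
      \<kappa> = "1 / (poly (P N) (lam T N k) * poly (pderiv (P (Suc N))) (lam T N k))"]
  by (simp add: christoffel_mu_def wvec_eq)

text \<open>At each eigenvalue the double sum splits: the sum over \<open>b\<close> reassembles the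
  right eigenvector and the sum over \<open>a\<close> the left one.\<close>

lemma psi_integral_sum:
  fixes f :: "real \<Rightarrow> real"
  assumes "f \<in> borel_measurable borel"
  shows "(\<Sum>a=1..p. \<Sum>b=1..q. psi_integral p q T \<nu> \<xi> A B N b a (\<lambda>x. poly (B b n) x * f x * poly (A a m) x))
    = (\<Sum>j=0..N. uvec q T B N j n * f (lam T N j) * wvec p T A N j m)"
proof -
  let ?x = "lam T N"
  let ?\<rho> = "christoffel_rho q T \<xi> B N" and ?\<mu> = "christoffel_mu p T \<nu> A N"
  have "psi_integral p q T \<nu> \<xi> A B N b a (\<lambda>x. poly (B b n) x * f x * poly (A a m) x)
      = (\<Sum>j=0..N. (poly (B b n) (?x j) * ?\<rho> j b) * f (?x j) * (poly (A a m) (?x j) * ?\<mu> j a))" for a b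
  proof -
    \<comment> \<open>Measurability of the integrand turns the integral against a Dirac measure into
      evaluation.\<close>
    have "poly r \<in> borel_measurable borel" for r :: "real poly"
      by (intro borel_measurable_continuous_onI continuous_intros)
    then have "(\<lambda>x. poly (B b n) x * f x * poly (A a m) x) \<in> borel_measurable borel"
      using assms by (intro borel_measurable_times) auto
    then show ?thesis
      unfolding psi_integral_def
      by (intro sum.cong) (simp_all add: integral_return mult_ac)
  qed
  then have "(\<Sum>a=1..p. \<Sum>b=1..q. psi_integral p q T \<nu> \<xi> A B N b a (\<lambda>x. poly (B b n) x * f x * poly (A a m) x))
    = (\<Sum>a=1..p. \<Sum>b=1..q. \<Sum>j=0..N.
        (poly (B b n) (?x j) * ?\<rho> j b) * f (?x j) * (poly (A a m) (?x j) * ?\<mu> j a))"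
    by simp
  also have "\<dots> = (\<Sum>a=1..p. \<Sum>j=0..N. \<Sum>b=1..q.
        (poly (B b n) (?x j) * ?\<rho> j b) * f (?x j) * (poly (A a m) (?x j) * ?\<mu> j a))"
    by (intro sum.cong refl sum.swap)
  also have "\<dots> = (\<Sum>a=1..p. \<Sum>j=0..N. uvec q T B N j n * f (?x j) * (poly (A a m) (?x j) * ?\<mu> j a))"
    by (simp only: uvec_christoffel sum_distrib_right)
  also have "\<dots> = (\<Sum>j=0..N. \<Sum>a=1..p. uvec q T B N j n * f (?x j) * (poly (A a m) (?x j) * ?\<mu> j a))"
    by (rule sum.swap)
  finally show ?thesis by (simp only: wvec_christoffel[of N _ m] sum_distrib_left)
qed

end

theorem proposition2p9:
  fixes p q N k n m :: nat
    and T :: "nat \<Rightarrow> nat \<Rightarrow> real"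
    and \<nu> \<xi> :: "real mat"
    and A B :: "nat \<Rightarrow> nat \<Rightarrow> real poly"
  assumes "p \<ge> 1" and "q \<ge> 1"
    and "stochastic T" and "pos_banded p q T"
    and "has_pos_bidiagonal_factorization p q T"
    and "lower_unitriangular p \<nu>" and "lower_unitriangular q \<xi>"
    and "left_recursion_polys p T \<nu> A" and "right_recursion_polys q T \<xi> B"
    and "n \<in> {0..N}" and "m \<in> {0..N}"
  shows
    "(That q T B N ^\<^sub>m k) $$ (n, m) =
       uvec q T B N 0 m / uvec q T B N 0 n *
       (\<Sum>a=1..p. \<Sum>b=1..q. psi_integral p q T \<nu> \<xi> A B N b a
          (\<lambda>x. poly (B b n) x * (x / lam T N 0) ^ k * poly (A a m) x))
     \<and>
     uvec q T B N 0 m / uvec q T B N 0 n *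
       (\<Sum>a=1..p. \<Sum>b=1..q. psi_integral p q T \<nu> \<xi> A B N b a
          (\<lambda>x. poly (B b n) x * (x / lam T N 0) ^ k * poly (A a m) x)) =
     uvec q T B N 0 m / uvec q T B N 0 n *
       (\<Sum>j=0..N. uvec q T B N j n * (lam T N j / lam T N 0) ^ k * wvec p T A N j m)
     \<and>
     uvec q T B N 0 m / uvec q T B N 0 n *
       (\<Sum>j=0..N. uvec q T B N j n * (lam T N j / lam T N 0) ^ k * wvec p T A N j m) =
     uvec q T B N 0 m * wvec p T A N 0 m +
       uvec q T B N 0 m / uvec q T B N 0 n *
       (\<Sum>j=1..N. uvec q T B N j n * (lam T N j / lam T N 0) ^ k * wvec p T A N j m)"
proof -
  have band: "0 < T n m" if "n \<le> m + p" "m \<le> n + q" for n m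
    using assms(4) that unfolding pos_banded_def by (metis (full_types))
  have out: "T n m = 0" if "\<not> (n \<le> m + p \<and> m \<le> n + q)" for n m
    using assms(4) that unfolding pos_banded_def by (metis (full_types))
  interpret two_sided_recursion p q T \<nu> \<xi> A B
  proof
    show "1 \<le> p" "1 \<le> q" "lower_unitriangular p \<nu>" "lower_unitriangular q \<xi>"
      "right_recursion_polys q T \<xi> B" by fact+
    show "right_recursion_polys p (smat_transpose T) \<nu> A"
      using assms(8) unfolding right_recursion_polys_def left_recursion_polys_def smat_transpose_def .
    show "pos_LU_product T"
      by (rule has_pos_bidiagonal_factorization_imp_LU[OF assms(5,1,2)])
    show "T n m = 0" if "n + q < m" for n m using that by (intro out) auto
    show "smat_transpose T n m = 0" if "n + p < m" for n m
      unfolding smat_transpose_def using that by (intro out) auto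
    show "0 \<le> T n m" for n m using assms(3) by (simp add: stochastic_def)
    show "0 < T n (Suc n)" for n using assms(2) by (intro band) auto
  qed
  have nm: "n \<le> N" "m \<le> N" using assms(10,11) by auto
  have sum: "(\<Sum>a=1..p. \<Sum>b=1..q. psi_integral p q T \<nu> \<xi> A B N b a
        (\<lambda>x. poly (B b n) x * (x / lam T N 0) ^ k * poly (A a m) x))
      = (\<Sum>j=0..N. uvec q T B N j n * (lam T N j / lam T N 0) ^ k * wvec p T A N j m)"
    by (rule psi_integral_sum) simp
  have "uvec q T B N 0 n \<noteq> 0" using U_lam_0_pos[OF nm(1)] by (simp add: uvec_eq)
  \<comment> \<open>In the term \<open>j = 0\<close> the ratio of eigenvalues is 1 and
    \<open>uvec q T B N 0 n\<close> cancels; both are nonzero by positivity.\<close>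
  then have split: "uvec q T B N 0 m / uvec q T B N 0 n *
       (\<Sum>j=0..N. uvec q T B N j n * (lam T N j / lam T N 0) ^ k * wvec p T A N j m) =
     uvec q T B N 0 m * wvec p T A N 0 m +
       uvec q T B N 0 m / uvec q T B N 0 n *
       (\<Sum>j=1..N. uvec q T B N j n * (lam T N j / lam T N 0) ^ k * wvec p T A N j m)"
    using lam_0_pos[of N] by (simp add: sum.atLeast_Suc_atMost distrib_left)
  show ?thesis unfolding sum
    using That_power[OF nm, of k] split by (simp add: atMost_atLeast0)
qed

end
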